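(* Let $X$ be a compact connected Riemann surface, let $q,z:X\to\mathbb P^1$ be nonconstant meromorphic maps, and let $p\in X$. Suppose that the dual conformal-net expression $\frac1H\widetilde\omega\,dz-H\omega\,dq$ is defined on a punctured neighborhood of $p$. Then its meromorphic continuation to $p$ is the logarithmic connection form $\Theta$ determined by the relative differential morphism $\mathcal Z$ of $q$ and $z$, and $$\operatorname{Res}_p\left(\frac1H\,\widetilde\omega\,dz-H\,\omega\,dq\right)=2i\bigl(r_z(p)-r_q(p)\bigr).$$ In particular, if this residue is nonzero, then $r_z(p)\neq r_q(p)$.
   Context: Ramification: $Tq:TX\to L_q:=q^*T\mathbb P^1$ and $Tz:TX\to L_z:=z^*T\mathbb P^1$ are the differentials; $r_q(p)$, $r_z(p)$ are the vanishing orders at $p$ of $Tq$, $Tz$ (ramification index minus one). Relative morphism and connection: $\mathcal Z=Tz\circ(Tq)^{-1}$ is a meromorphic section of the line bundle $\mathcal H=\operatorname{Hom}(L_q,L_z)$. In a local frame $E_\alpha$ of $\mathcal H$ write $\mathcal Z=g_\alpha E_\alpha$. The logarithmic connection determined by $\mathcal Z$ has local operators $D_\alpha=d-\alpha_\alpha$, $\alpha_\alpha=d\log g_\alpha=g_\alpha^{-1}dg_\alpha$, and normalized local forms $\Theta_\alpha=2i\,\alpha_\alpha$ (collectively denoted $\Theta$). If $E_\beta=h_{\alpha\beta}E_\alpha$, then $\alpha_\beta=\alpha_\alpha-d\log h_{\alpha\beta}$. The residue $\operatorname{Res}_p\Theta$ is the residue at $p$ of $\Theta_\alpha$ for any nowhere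 vanishing holomorphic frame $E_\alpha$ of $\mathcal H$ near $p$. Dual conformal nets: where $q=q_1+iq_2$ is a local conformal coordinate and $z=z(q)$ is holomorphic with $z_q=dz/dq\neq0$, put $H=|z_q|$ (the conformal factor of the metric $ds^2=H^2(dq_1^2+dq_2^2)$), $\widetilde H=H^{-1}$, $\omega=-\frac{2i}{H}\partial_q\log H$, $\widetilde\omega=-\frac{2i}{\widetilde H}\partial_z\log\widetilde H$, where $\partial_q=\frac12(\partial_{q_1}-i\partial_{q_2})$ and $\partial_z=z_q^{-1}\partial_q$. The dual conformal-net expression is $\frac1H\widetilde\omega\,dz-H\omega\,dq$; it is regarded as the local form of the connection $\Theta$ in the coordinate frame $\frac{\partial}{\partial z}\otimes dq$ of $\mathcal H$. Its meromorphic continuation and its residue at $p$ are understood as those of this connection form after passing, by the gauge law above, to a nowhere vanishing holomorphic frame of $\mathcal H$ near $p$. *)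

theory Defs
  imports "HOL-Complex_Analysis.Complex_Analysis"
begin

section \<open>Riemann surfaces and holomorphic maps\<close>

type_synonym 'a chart = "'a set \<times> ('a \<Rightarrow> complex)"

record 'a surface =
  topo :: "'a topology"
  atlas :: "'a chart set"

abbreviation points :: "'a surface \<Rightarrow> 'a set" where
  "points M \<equiv> topspace (topo M)"

definition chart_inv :: "'a chart \<Rightarrow> complex \<Rightarrow> 'a" where
  "chart_inv c = inv_into (fst c) (snd c)"

text \<open>The atlas is not required to be maximal. Connectedness and compactness are separate hypotheses.\<close>

definition riemann_surface :: "'a surface \<Rightarrow> bool" where
  "riemann_surface M \<longleftrightarrow>
     Hausdorff_space (topo M) \<and>
     (\<Union>c\<in>atlas M. fst c) = points M \<and>
     (\<forall>c\<in>atlas M. openin (topo M) (fst c) \<and> open (snd c ` fst c) \<and>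
        homeomorphic_map (subtopology (topo M) (fst c)) (top_of_set (snd c ` fst c)) (snd c)) \<and>
     (\<forall>c\<in>atlas M. \<forall>d\<in>atlas M.
        (snd d \<circ> chart_inv c) holomorphic_on (snd c ` (fst c \<inter> fst d)))"

definition holomorphic_map :: "'a surface \<Rightarrow> 'b surface \<Rightarrow> ('a \<Rightarrow> 'b) \<Rightarrow> bool" where
  "holomorphic_map M N f \<longleftrightarrow>
     continuous_map (topo M) (topo N) f \<and>
     (\<forall>c\<in>atlas M. \<forall>d\<in>atlas N.
        (snd d \<circ> f \<circ> chart_inv c) holomorphic_on (snd c ` (fst c \<inter> f -` fst d)))"

text \<open>The complex projective line as the one-point compactification of the plane;
  \<open>None\<close> is the point at infinity.\<close>

definition affine_chart :: "complex option chart" where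
  "affine_chart = (range Some, the)"

definition infinity_chart :: "complex option chart" where
  "infinity_chart = (- {Some 0}, \<lambda>y. case y of None \<Rightarrow> 0 | Some w \<Rightarrow> inverse w)"

definition sphere_surface :: "complex option surface" where
  "sphere_surface =
     \<lparr>topo = Alexandroff_compactification euclidean, atlas = {affine_chart, infinity_chart}\<rparr>"


section \<open>Tangent spaces and differentials\<close>

definition charts_at :: "'a surface \<Rightarrow> 'a \<Rightarrow> 'a chart set" where
  "charts_at M x = {c \<in> atlas M. x \<in> fst c}"

definition chart_at :: "'a surface \<Rightarrow> 'a \<Rightarrow> 'a chart" where
  "chart_at M x = (SOME c. c \<in> charts_at M x)"

text \<open>A tangent vector at \<open>x\<close> is the family of its components in all the charts around \<open>x\<close>,
  transforming by the derivatives of the coordinate changes (and 0 at irrelevant arguments).\<close>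

type_synonym 'a tvec = "'a chart \<Rightarrow> complex"

definition tangent_space :: "'a surface \<Rightarrow> 'a \<Rightarrow> 'a tvec set" where
  "tangent_space M x =
     {v. (\<forall>c\<in>charts_at M x. \<forall>d\<in>charts_at M x.
            v d = deriv (snd d \<circ> chart_inv c) (snd c x) * v c) \<and>
         (\<forall>c. c \<notin> charts_at M x \<longrightarrow> v c = 0)}"

text \<open>The vector \<open>\<partial>/\<partial>c\<close> at \<open>x\<close> of the coordinate \<open>c\<close>.\<close>

definition coord_vec :: "'a surface \<Rightarrow> 'a chart \<Rightarrow> 'a \<Rightarrow> 'a tvec" where
  "coord_vec M c x =
     (\<lambda>d. if d \<in> charts_at M x then deriv (snd d \<circ> chart_inv c) (snd c x) else 0)"

definition differential ::
    "'a surface \<Rightarrow> 'b surface \<Rightarrow> ('a \<Rightarrow> 'b) \<Rightarrow> 'a \<Rightarrow> 'a tvec \<Rightarrow> 'b tvec" where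
  "differential M N f x v =
     (\<lambda>d. if d \<in> charts_at N (f x)
          then deriv (snd d \<circ> f \<circ> chart_inv (chart_at M x)) (snd (chart_at M x) x) * v (chart_at M x)
          else 0)"

text \<open>Order of vanishing at \<open>p\<close> of the section \<open>Tf\<close> of \<open>Hom(TM, f\<^sup>*TN)\<close>, read off from its coefficient
  in the coordinate frames; it does not depend on the chosen charts.\<close>

definition vanishing_order :: "'a surface \<Rightarrow> 'b surface \<Rightarrow> ('a \<Rightarrow> 'b) \<Rightarrow> 'a \<Rightarrow> int" where
  "vanishing_order M N f p =
     (let c = chart_at M p; d = chart_at N (f p) in
      zorder (\<lambda>w. differential M N f (chart_inv c w) (coord_vec M c (chart_inv c w)) d) (snd c p))"


section \<open>One-forms and residues\<close>

type_synonym 'a form = "'a \<Rightarrow> 'a tvec \<Rightarrow> complex"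

definition fun_d :: "'a surface \<Rightarrow> ('a \<Rightarrow> complex) \<Rightarrow> 'a form" where
  "fun_d M g x v = deriv (g \<circ> chart_inv (chart_at M x)) (snd (chart_at M x) x) * v (chart_at M x)"

definition dlog :: "'a surface \<Rightarrow> ('a \<Rightarrow> complex) \<Rightarrow> 'a form" where
  "dlog M g x v = inverse (g x) * fun_d M g x v"

definition form_coeff :: "'a surface \<Rightarrow> 'a chart \<Rightarrow> 'a form \<Rightarrow> complex \<Rightarrow> complex" where
  "form_coeff M c \<eta> w = \<eta> (chart_inv c w) (coord_vec M c (chart_inv c w))"

text \<open>Both notions depend only on the values of the form on a punctured neighbourhood of \<open>p\<close>.\<close>

definition meromorphic_form_at :: "'a surface \<Rightarrow> 'a form \<Rightarrow> 'a \<Rightarrow> bool" where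
  "meromorphic_form_at M \<eta> p \<longleftrightarrow> (\<forall>c\<in>charts_at M p. form_coeff M c \<eta> meromorphic_on {snd c p})"

definition form_residue :: "'a surface \<Rightarrow> 'a form \<Rightarrow> 'a \<Rightarrow> complex" where
  "form_residue M \<eta> p = residue (form_coeff M (chart_at M p) \<eta>) (snd (chart_at M p) p)"


section \<open>The line bundle \<open>Hom(L\<^sub>q, L\<^sub>z)\<close> and its logarithmic connection\<close>

text \<open>Here \<open>L\<^sub>q\<close> and \<open>L\<^sub>z\<close> are the pullbacks of \<open>TN\<close> under \<open>q\<close> and \<open>z\<close>.\<close>

definition hom_fibre ::
    "'b surface \<Rightarrow> ('a \<Rightarrow> 'b) \<Rightarrow> ('a \<Rightarrow> 'b) \<Rightarrow> 'a \<Rightarrow> ('b tvec \<Rightarrow> 'b tvec) set" where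
  "hom_fibre N q z x =
     {L. (\<forall>v\<in>tangent_space N (q x). L v \<in> tangent_space N (z x)) \<and>
         (\<forall>v\<in>tangent_space N (q x). \<forall>w\<in>tangent_space N (q x). \<forall>a b.
            L (\<lambda>c. a * v c + b * w c) = (\<lambda>c. a * L v c + b * L w c))}"

type_synonym ('a, 'b) hom_section = "'a \<Rightarrow> 'b tvec \<Rightarrow> 'b tvec"

definition holomorphic_frame ::
    "'a surface \<Rightarrow> 'b surface \<Rightarrow> ('a \<Rightarrow> 'b) \<Rightarrow> ('a \<Rightarrow> 'b) \<Rightarrow> 'a set \<Rightarrow> ('a, 'b) hom_section \<Rightarrow> bool" where
  "holomorphic_frame M N q z V E \<longleftrightarrow>
     openin (topo M) V \<and>
     (\<forall>x\<in>V. E x \<in> hom_fibre N q z x \<and> (\<exists>v\<in>tangent_space N (q x). E x v \<noteq> (\<lambda>_. 0))) \<and>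
     (\<forall>c\<in>atlas M. \<forall>d\<in>atlas N. \<forall>e\<in>atlas N.
        (\<lambda>w. E (chart_inv c w) (coord_vec N d (q (chart_inv c w))) e)
          holomorphic_on (snd c ` (fst c \<inter> V \<inter> q -` fst d \<inter> z -` fst e)))"

text \<open>The function \<open>g\<close> with \<open>S = g E\<close>, meaningful at those points where \<open>S\<close> is regular and \<open>E\<close> is
  a nonzero element of the fibre.\<close>

definition frame_coeff ::
    "'b surface \<Rightarrow> ('a \<Rightarrow> 'b) \<Rightarrow> ('a, 'b) hom_section \<Rightarrow> ('a, 'b) hom_section \<Rightarrow> 'a \<Rightarrow> complex" where
  "frame_coeff N q S E x = (THE g. \<forall>v\<in>tangent_space N (q x). S x v = (\<lambda>e. g * E x v e))"

text \<open>Relevant only off the zeros of \<open>Tq\<close>, which are where the section is allowed to have poles.\<close>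

definition relative_morphism ::
    "'a surface \<Rightarrow> 'b surface \<Rightarrow> ('a \<Rightarrow> 'b) \<Rightarrow> ('a \<Rightarrow> 'b) \<Rightarrow> ('a, 'b) hom_section" where
  "relative_morphism M N q z x =
     differential M N z x \<circ> inv_into (tangent_space M x) (differential M N q x)"

definition Theta ::
    "'a surface \<Rightarrow> 'b surface \<Rightarrow> ('a \<Rightarrow> 'b) \<Rightarrow> ('a \<Rightarrow> 'b) \<Rightarrow> ('a, 'b) hom_section \<Rightarrow> 'a form" where
  "Theta M N q z E x v =
     2 * \<i> * dlog M (frame_coeff N q (relative_morphism M N q z) E) x v"

text \<open>If \<open>E' = h E\<close>, the connection with normalized form \<open>\<eta>\<close> in the frame \<open>E\<close> has the normalized form
  \<open>\<eta> - 2i dlog h\<close> in the frame \<open>E'\<close>.\<close>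

definition change_frame ::
    "'a surface \<Rightarrow> 'b surface \<Rightarrow> ('a \<Rightarrow> 'b) \<Rightarrow> ('a, 'b) hom_section \<Rightarrow> ('a, 'b) hom_section \<Rightarrow>
      'a form \<Rightarrow> 'a form" where
  "change_frame M N q E E' \<eta> x v = \<eta> x v - 2 * \<i> * dlog M (frame_coeff N q E' E) x v"


section \<open>Dual conformal nets\<close>

text \<open>The operator \<open>1/2 (\<partial>\<^sub>1 - i \<partial>\<^sub>2)\<close>.\<close>

definition wirtinger :: "(complex \<Rightarrow> complex) \<Rightarrow> complex \<Rightarrow> complex" where
  "wirtinger f a =
     (vector_derivative (\<lambda>t::real. f (a + of_real t)) (at 0)
       - \<i> * vector_derivative (\<lambda>t::real. f (a + \<i> * of_real t)) (at 0)) / 2"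

text \<open>In the next five definitions \<open>\<zeta>\<close> is \<open>z\<close> as a function of the coordinate \<open>q\<close>.\<close>

definition net_H :: "(complex \<Rightarrow> complex) \<Rightarrow> complex \<Rightarrow> real" where
  "net_H \<zeta> w = norm (deriv \<zeta> w)"

definition dual_net_H :: "(complex \<Rightarrow> complex) \<Rightarrow> complex \<Rightarrow> real" where
  "dual_net_H \<zeta> w = inverse (net_H \<zeta> w)"

definition wirtinger_z :: "(complex \<Rightarrow> complex) \<Rightarrow> (complex \<Rightarrow> complex) \<Rightarrow> complex \<Rightarrow> complex" where
  "wirtinger_z \<zeta> f w = inverse (deriv \<zeta> w) * wirtinger f w"

definition net_omega :: "(complex \<Rightarrow> complex) \<Rightarrow> complex \<Rightarrow> complex" where
  "net_omega \<zeta> w =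
     - (2 * \<i> / of_real (net_H \<zeta> w)) * wirtinger (\<lambda>u. of_real (ln (net_H \<zeta> u))) w"

definition dual_net_omega :: "(complex \<Rightarrow> complex) \<Rightarrow> complex \<Rightarrow> complex" where
  "dual_net_omega \<zeta> w =
     - (2 * \<i> / of_real (dual_net_H \<zeta> w)) * wirtinger_z \<zeta> (\<lambda>u. of_real (ln (dual_net_H \<zeta> u))) w"

abbreviation affine :: "('a \<Rightarrow> complex option) \<Rightarrow> 'a \<Rightarrow> complex" where
  "affine f \<equiv> the \<circ> f"

definition z_of_q ::
    "('a \<Rightarrow> complex option) \<Rightarrow> ('a \<Rightarrow> complex option) \<Rightarrow> 'a set \<Rightarrow> complex \<Rightarrow> complex" where
  "z_of_q q z W = affine z \<circ> inv_into W (affine q)"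

text \<open>On a patch \<open>q\<close> is a conformal coordinate (for holomorphic \<open>q\<close>, injectivity suffices) and \<open>z\<close> is
  finite-valued with \<open>dz/dq \<noteq> 0\<close>.\<close>

definition net_patch ::
    "'a surface \<Rightarrow> ('a \<Rightarrow> complex option) \<Rightarrow> ('a \<Rightarrow> complex option) \<Rightarrow> 'a set \<Rightarrow> bool" where
  "net_patch M q z W \<longleftrightarrow>
     openin (topo M) W \<and> (\<forall>x\<in>W. q x \<noteq> None \<and> z x \<noteq> None) \<and> inj_on (affine q) W \<and>
     (\<forall>x\<in>W. deriv (z_of_q q z W) (affine q x) \<noteq> 0)"

definition dual_net_defined ::
    "'a surface \<Rightarrow> ('a \<Rightarrow> complex option) \<Rightarrow> ('a \<Rightarrow> complex option) \<Rightarrow> 'a \<Rightarrow> bool" where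
  "dual_net_defined M q z x \<longleftrightarrow> (\<exists>W. net_patch M q z W \<and> x \<in> W)"

text \<open>The expression \<open>(1/H) \<omega>' dz - H \<omega> dq\<close>, where \<open>\<omega>'\<close> is the dual of \<open>\<omega>\<close>. All derivatives being local,
  the value at \<open>x\<close> does not depend on the patch.\<close>

definition dual_net_form ::
    "'a surface \<Rightarrow> ('a \<Rightarrow> complex option) \<Rightarrow> ('a \<Rightarrow> complex option) \<Rightarrow> 'a form" where
  "dual_net_form M q z x v =
     (let W = (SOME W. net_patch M q z W \<and> x \<in> W);
          \<zeta> = z_of_q q z W;
          w = affine q x
      in 1 / of_real (net_H \<zeta> w) * dual_net_omega \<zeta> w * fun_d M (affine z) x v
         - of_real (net_H \<zeta> w) * net_omega \<zeta> w * fun_d M (affine q) x v)"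

text \<open>The frame \<open>\<partial>/\<partial>z \<otimes> dq\<close>, over the points where \<open>q\<close> and \<open>z\<close> are finite: it maps \<open>v\<close> to
  \<open>dq(v) \<partial>/\<partial>z\<close>, where \<open>dq(v)\<close> is the component of \<open>v\<close> in the affine chart.\<close>

definition coordinate_frame ::
    "('a \<Rightarrow> complex option) \<Rightarrow> ('a, complex option) hom_section" where
  "coordinate_frame z x v =
     (\<lambda>e. v affine_chart * coord_vec sphere_surface affine_chart (z x) e)"


section \<open>The sphere is a Riemann surface, and local frames exist\<close>

lemma riemann_surface_sphere: "riemann_surface sphere_surface"
proof -
  let ?T = "Alexandroff_compactification (euclidean :: complex topology)"
  have T: "openin ?T V \<longleftrightarrow> (\<exists>U. open U \<and> V = Some ` U) \<or>
      (\<exists>C. compact C \<and> V = insert None (Some ` (- C)))" for V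
    unfolding openin_Alexandroff_compactification
    by (auto simp: compact_imp_closed Compl_eq_Diff_UNIV)
  have T1: "openin ?T (Some ` U)" if "open U" for U using T that by blast
  have T2: "openin ?T (insert None (Some ` (- C)))" if "compact C" for C using T that by blast
  have UN: "insert None (range Some) = (UNIV :: complex option set)"
    by (simp add: UNIV_option_conv)
  have top: "topspace ?T = UNIV"
    using UN by simp
  have haus: "Hausdorff_space ?T"
    by (simp add: Hausdorff_space_Alexandroff_compactification locally_compact_space_euclidean)
  have fI: "fst infinity_chart = insert None (Some ` (- {0}))"
    by (auto simp: infinity_chart_def)
  have fA: "fst affine_chart = range Some" by (simp add: affine_chart_def)
  have injA: "inj_on (snd affine_chart) (fst affine_chart)"
    by (auto simp: affine_chart_def inj_on_def)
  have injI: "inj_on (snd infinity_chart) (fst infinity_chart)"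
    by (auto simp: infinity_chart_def inj_on_def split: option.splits)
  have invA: "chart_inv affine_chart w = Some w" for w
    unfolding chart_inv_def using injA by (intro inv_into_f_eq) (auto simp: affine_chart_def)
  have invI: "chart_inv infinity_chart w = (if w = 0 then None else Some (inverse w))" for w
    unfolding chart_inv_def using injI
    by (intro inv_into_f_eq) (auto simp: infinity_chart_def)
  have imA: "snd affine_chart ` fst affine_chart = UNIV"
    by (force simp: affine_chart_def)
  have imI: "snd infinity_chart ` fst infinity_chart = UNIV"
  proof -
    have "w \<in> snd infinity_chart ` fst infinity_chart" for w
      by (rule image_eqI[of _ _ "if w = 0 then None else Some (inverse w)"])
        (auto simp: infinity_chart_def)
    then show ?thesis by blast
  qed
  have oI: "openin ?T (fst infinity_chart)"
    unfolding T fI by (metis compact_sing)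
  have oA: "openin ?T (fst affine_chart)"
    unfolding T fA by blast
  have oinv: "open (inverse ` U)" if "open U" "0 \<notin> U" for U :: "complex set"
  proof -
    have "inverse ` U = inverse -` U \<inter> (- {0})"
      using that(2) by (force simp: image_iff)
    moreover have "continuous_on (- {0::complex}) inverse"
      by (intro continuous_intros) auto
    then have "open (- {0} \<inter> inverse -` U)"
      using that(1) by (intro continuous_open_preimage) auto
    then have "open (inverse -` U \<inter> - {0})" by (simp add: Int_commute)
    ultimately show ?thesis by simp
  qed
  have homeo: "homeomorphic_map (subtopology ?T (fst c)) (top_of_set UNIV) (snd c)"
    if o: "openin ?T (fst c)" and inj: "inj_on (snd c) (fst c)" and im: "snd c ` fst c = UNIV"
      and pre: "\<And>B. open B \<Longrightarrow> openin ?T {y \<in> fst c. snd c y \<in> B}"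
      and img: "\<And>V. openin ?T V \<Longrightarrow> V \<subseteq> fst c \<Longrightarrow> open (snd c ` V)" for c :: "complex option chart"
  proof (rule bijective_open_imp_homeomorphic_map)
    show "continuous_map (subtopology ?T (fst c)) (top_of_set UNIV) (snd c)"
      unfolding continuous_map using o pre im top
      by (auto simp: openin_open_subtopology)
    show "open_map (subtopology ?T (fst c)) (top_of_set UNIV) (snd c)"
      unfolding open_map_def using o img by (auto simp: openin_open_subtopology)
  qed (use top inj im in auto)
  have hA: "homeomorphic_map (subtopology ?T (fst affine_chart)) (top_of_set UNIV) (snd affine_chart)"
  proof (rule homeo[OF oA injA imA])
    fix B :: "complex set" assume B: "open B"
    have "{y \<in> fst affine_chart. snd affine_chart y \<in> B} = Some ` B"
      by (auto simp: affine_chart_def)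
    then show "openin ?T {y \<in> fst affine_chart. snd affine_chart y \<in> B}"
      using T1[OF B] by presburger
  next
    fix V assume "openin ?T V" "V \<subseteq> fst affine_chart"
    then obtain U where "open U" "V = Some ` U" unfolding T fA by auto
    then show "open (snd affine_chart ` V)" by (simp add: affine_chart_def image_image)
  qed
  have hI: "homeomorphic_map (subtopology ?T (fst infinity_chart)) (top_of_set UNIV) (snd infinity_chart)"
  proof (rule homeo[OF oI injI imI])
    fix B :: "complex set" assume B: "open B"
    show "openin ?T {y \<in> fst infinity_chart. snd infinity_chart y \<in> B}"
    proof (cases "0 \<in> B")
      case False
      have "{y \<in> fst infinity_chart. snd infinity_chart y \<in> B} = Some ` inverse ` B"
      proof (intro equalityI subsetI)
        fix y assume y: "y \<in> {y \<in> fst infinity_chart. snd infinity_chart y \<in> B}"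
        then obtain w where w: "y = Some w" "inverse w \<in> B"
          using False by (auto simp: infinity_chart_def split: option.splits)
        then have "w \<in> inverse ` B" by (metis image_eqI inverse_inverse_eq)
        then show "y \<in> Some ` inverse ` B" using w by blast
      qed (use False in \<open>auto simp: infinity_chart_def\<close>)
      then show ?thesis using T1[OF oinv[OF B False]] by presburger
    next
      case True
      define C where "C = - inverse ` (B - {0})  - {0}"
      define C' where "C' = insert 0 C"
      have B0: "open (inverse ` (B - {0}))" using B by (intro oinv) auto
      have mem: "w \<in> inverse ` (B - {0}) \<longleftrightarrow> w \<noteq> 0 \<and> inverse w \<in> B" for w
      proof
        assume "w \<noteq> 0 \<and> inverse w \<in> B"
        then show "w \<in> inverse ` (B - {0})" by (intro image_eqI[of _ _ "inverse w"]) auto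
      qed auto
      have "C' = - inverse ` (B - {0})" by (auto simp: C'_def C_def)
      then have cl: "closed C'" using B0 by (simp add: closed_def)
      obtain r where r: "r > 0" "ball 0 r \<subseteq> B" using B True openE by blast
      have "norm w \<le> inverse r" if "w \<in> C'" for w
      proof (cases "w = 0")
        case False
        then have "inverse w \<notin> B" using that mem by (auto simp: C'_def C_def)
        then have "r \<le> norm (inverse w)" using r(2) by (force simp: not_less)
        then have "r \<le> inverse (norm w)" by (simp add: norm_inverse)
        then show ?thesis using r(1) False le_imp_inverse_le by fastforce
      qed (use r in auto)
      then have "bounded C'" unfolding bounded_iff by blast
      then have "compact C'" using cl compact_eq_bounded_closed by blast
      moreover have "{y \<in> fst infinity_chart. snd infinity_chart y \<in> B} = insert None (Some ` (- C'))"
      proof -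
        have "y \<in> {y \<in> fst infinity_chart. snd infinity_chart y \<in> B} \<longleftrightarrow> y \<in> insert None (Some ` (- C'))" for y
          using True mem by (cases y) (auto simp: infinity_chart_def C'_def C_def)
        then show ?thesis by blast
      qed
      ultimately show ?thesis using T2 by presburger
    qed
  next
    fix V assume V: "openin ?T V" "V \<subseteq> fst infinity_chart"
    from V(1) consider U where "open U" "V = Some ` U" | C where "compact C" "V = insert None (Some ` (- C))"
      using T[of V] by metis
    then show "open (snd infinity_chart ` V)"
    proof cases
      case 1
      then have "0 \<notin> U" "snd infinity_chart ` V = inverse ` U"
        using V(2) by (auto simp: infinity_chart_def image_image)
      then show ?thesis using oinv 1 by simp
    next
      case 2
      then have C0: "0 \<in> C" using V(2) by (auto simp: infinity_chart_def)
      have e: "snd infinity_chart ` V = insert 0 (inverse ` (- C))"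
        using 2 by (auto simp: infinity_chart_def image_image)
      have o: "open (inverse ` (- C))" using 2 C0 by (intro oinv) (auto simp: compact_imp_closed open_Compl)
      obtain R where R: "R > 0" "\<And>w. w \<in> C \<Longrightarrow> norm w \<le> R"
        using 2 compact_imp_bounded bounded_pos by metis
      have "ball 0 (inverse R) \<subseteq> insert 0 (inverse ` (- C))"
      proof
        fix w :: complex assume w: "w \<in> ball 0 (inverse R)"
        show "w \<in> insert 0 (inverse ` (- C))"
        proof (cases "w = 0")
          case False
          then have "norm w < inverse R" using w by simp
          then have "R < inverse (norm w)"
            using R(1) False by (metis inverse_inverse_eq less_imp_inverse_less zero_less_norm_iff)
          then have "inverse w \<notin> C" using R(2)[of "inverse w"] by (auto simp: norm_inverse)
          then show ?thesis by (metis ComplI image_eqI insertCI inverse_inverse_eq)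
        qed auto
      qed
      then have "insert 0 (inverse ` (- C)) = ball 0 (inverse R) \<union> inverse ` (- C)"
        using R(1) by auto
      then show ?thesis unfolding e using o by (metis open_Un open_ball)
    qed
  qed
  have hol: "(snd d \<circ> chart_inv c) holomorphic_on (snd c ` (fst c \<inter> fst d))"
    if "c \<in> {affine_chart, infinity_chart}" "d \<in> {affine_chart, infinity_chart}" for c d
  proof -
    have id: "(\<lambda>w. w) holomorphic_on S" "inverse holomorphic_on (S - {0})" for S :: "complex set"
      by (auto intro!: holomorphic_intros)
    have AI: "snd affine_chart ` (fst affine_chart \<inter> fst infinity_chart) = UNIV - {0}"
      by (force simp: affine_chart_def infinity_chart_def)
    have IA: "snd infinity_chart ` (fst infinity_chart \<inter> fst affine_chart) \<subseteq> UNIV - {0}"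
      by (auto simp: affine_chart_def infinity_chart_def)
    have "snd affine_chart \<circ> chart_inv affine_chart = (\<lambda>w. w)"
      by (rule ext) (simp only: o_apply invA, simp add: affine_chart_def)
    moreover have "snd infinity_chart \<circ> chart_inv infinity_chart = (\<lambda>w. w)"
      by (rule ext) (simp only: o_apply invI, simp add: infinity_chart_def)
    moreover have "snd infinity_chart \<circ> chart_inv affine_chart = inverse"
      by (rule ext) (simp only: o_apply invA, simp add: infinity_chart_def)
    moreover have "(snd affine_chart \<circ> chart_inv infinity_chart) holomorphic_on (UNIV - {0})"
      by (rule holomorphic_transform[OF id(2)[of UNIV]]) (simp only: o_apply invI, simp add: affine_chart_def)
    ultimately show ?thesis
      using that id(1) id(2)[of UNIV] AI holomorphic_on_subset[OF _ IA] by (elim insertE emptyE) (simp_all only:)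
  qed
  have cov: "fst affine_chart \<union> fst infinity_chart = UNIV"
    using UN by (auto simp: affine_chart_def infinity_chart_def)
  show ?thesis
    unfolding riemann_surface_def using haus top cov oA oI hA hI imA imI hol
    by (auto simp: sphere_surface_def)
qed

lemma charts_open:
  assumes "riemann_surface M" "c \<in> atlas M" "openin (topo M) W"
  shows "open (snd c ` (fst c \<inter> W))"
proof -
  let ?T = "subtopology (topo M) (fst c)"
  have h: "homeomorphic_map ?T (top_of_set (snd c ` fst c)) (snd c)" and o: "open (snd c ` fst c)"
    using assms unfolding riemann_surface_def by auto
  have "openin ?T (fst c \<inter> W)" using assms(3) openin_subtopology_Int2 by blast
  then have "openin (top_of_set (snd c ` fst c)) (snd c ` (fst c \<inter> W))"
    using homeomorphic_imp_open_map[OF h] unfolding open_map_def by blast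
  then show ?thesis using o openin_open_trans by blast
qed

lemma chart_inj:
  assumes "riemann_surface M" "c \<in> atlas M"
  shows "inj_on (snd c) (fst c)" "fst c \<subseteq> points M" "openin (topo M) (fst c)"
proof -
  have h: "homeomorphic_map (subtopology (topo M) (fst c)) (top_of_set (snd c ` fst c)) (snd c)"
    and o: "openin (topo M) (fst c)"
    using assms unfolding riemann_surface_def by auto
  show o: "openin (topo M) (fst c)" by fact
  show s: "fst c \<subseteq> points M" using o openin_subset by blast
  show "inj_on (snd c) (fst c)" using homeomorphic_imp_injective_map[OF h] s
    by (simp add: Int_absorb1)
qed

lemma chart_inv:
  assumes "riemann_surface M" "c \<in> atlas M" "x \<in> fst c"
  shows "chart_inv c (snd c x) = x"
  using chart_inj[OF assms(1,2)] assms(3) unfolding chart_inv_def by simp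

lemma trans_diff:
  assumes M: "riemann_surface M" and "c \<in> charts_at M x" "d \<in> charts_at M x"
  shows "(snd d \<circ> chart_inv c) field_differentiable (at (snd c x))"
proof -
  have c: "c \<in> atlas M" "x \<in> fst c" and d: "d \<in> atlas M" "x \<in> fst d" using assms by (auto simp: charts_at_def)
  have "(snd d \<circ> chart_inv c) holomorphic_on (snd c ` (fst c \<inter> fst d))"
    using M c d unfolding riemann_surface_def by blast
  moreover have "open (snd c ` (fst c \<inter> fst d))"
    using charts_open[OF M c(1)] chart_inj[OF M d(1)] by blast
  ultimately show ?thesis using c d holomorphic_on_imp_differentiable_at by blast
qed

lemma trans_cocycle:
  assumes M: "riemann_surface M" and c: "c \<in> charts_at M x" and d: "d \<in> charts_at M x" and e: "e \<in> charts_at M x"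
  shows "deriv (snd e \<circ> chart_inv c) (snd c x) = 
     deriv (snd e \<circ> chart_inv d) (snd d x) * deriv (snd d \<circ> chart_inv c) (snd c x)"
proof -
  have c': "c \<in> atlas M" "x \<in> fst c" and d': "d \<in> atlas M" "x \<in> fst d" using assms by (auto simp: charts_at_def)
  have inv: "chart_inv c (snd c x) = x" using chart_inv[OF M c'] .
  have o: "open (snd c ` (fst c \<inter> fst d))"
    using charts_open[OF M c'(1)] chart_inj[OF M d'(1)] by blast
  have "deriv (snd e \<circ> chart_inv c) (snd c x) = deriv ((snd e \<circ> chart_inv d) \<circ> (snd d \<circ> chart_inv c)) (snd c x)"
  proof (rule deriv_cong_ev)
    show "\<forall>\<^sub>F w in nhds (snd c x). (snd e \<circ> chart_inv c) w = ((snd e \<circ> chart_inv d) \<circ> (snd d \<circ> chart_inv c)) w"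
      unfolding eventually_nhds
      using o c' d' chart_inv[OF M c'(1)] chart_inv[OF M d'(1)]
      by (intro exI[of _ "snd c ` (fst c \<inter> fst d)"]) auto
  qed auto
  also have "\<dots> = deriv (snd e \<circ> chart_inv d) ((snd d \<circ> chart_inv c) (snd c x)) * deriv (snd d \<circ> chart_inv c) (snd c x)"
    using trans_diff[OF M c d] trans_diff[OF M d e] inv by (intro deriv_chain) auto
  finally show ?thesis using inv by simp
qed

lemma coord_vec_tangent:
  assumes "riemann_surface M" "c \<in> charts_at M x"
  shows "coord_vec M c x \<in> tangent_space M x"
  unfolding tangent_space_def
proof (intro CollectI conjI ballI allI impI)
  fix d e assume de: "d \<in> charts_at M x" "e \<in> charts_at M x"
  show "coord_vec M c x e = deriv (snd e \<circ> chart_inv d) (snd d x) * coord_vec M c x d"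
    unfolding coord_vec_def using trans_cocycle[OF assms(1,2) de] de by presburger
qed (simp add: coord_vec_def)

lemma coord_vec_self:
  assumes "riemann_surface M" "c \<in> charts_at M x"
  shows "coord_vec M c x c = 1"
proof -
  have c: "c \<in> atlas M" "x \<in> fst c" using assms by (auto simp: charts_at_def)
  have o: "open (snd c ` fst c)" using assms c unfolding riemann_surface_def by blast
  have "deriv (snd c \<circ> chart_inv c) (snd c x) = deriv (\<lambda>w. w) (snd c x)"
  proof (rule deriv_cong_ev)
    show "\<forall>\<^sub>F w in nhds (snd c x). (snd c \<circ> chart_inv c) w = w"
      unfolding eventually_nhds using o c chart_inv[OF assms(1) c(1)]
      by (intro exI[of _ "snd c ` fst c"]) auto
  qed auto
  then show ?thesis using assms by (simp add: coord_vec_def)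
qed

lemma tangent_space_scale:
  assumes t: "v \<in> tangent_space M x"
  shows "(\<lambda>c. a * v c) \<in> tangent_space M x"
  unfolding tangent_space_def
proof (intro CollectI conjI ballI allI impI)
  fix c d assume "c \<in> charts_at M x" "d \<in> charts_at M x"
  then have "v d = deriv (snd d \<circ> chart_inv c) (snd c x) * v c"
    using t unfolding tangent_space_def by blast
  then show "a * v d = deriv (snd d \<circ> chart_inv c) (snd c x) * (a * v c)"
    by (metis mult.left_commute)
next
  fix c assume "c \<notin> charts_at M x"
  then have "v c = 0" using t unfolding tangent_space_def by blast
  then show "a * v c = 0" by simp
qed

lemma holomorphic_frame_exists:
  assumes M: "riemann_surface M" and N: "riemann_surface N"
    and q: "holomorphic_map M N q" and z: "holomorphic_map M N z" and p: "p \<in> points M"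
  shows "\<exists>V E. holomorphic_frame M N q z V E \<and> p \<in> V"
proof -
  have cq: "continuous_map (topo M) (topo N) q" and cz: "continuous_map (topo M) (topo N) z"
    using q z unfolding holomorphic_map_def by auto
  have "q p \<in> points N" "z p \<in> points N" using cq cz p by (auto simp: continuous_map_def)
  then obtain d0 e0 where d0: "d0 \<in> atlas N" "q p \<in> fst d0" and e0: "e0 \<in> atlas N" "z p \<in> fst e0"
    using N unfolding riemann_surface_def by (metis (no_types, lifting) UN_iff)
  define V where "V = {x \<in> points M. q x \<in> fst d0} \<inter> {x \<in> points M. z x \<in> fst e0}"
  have oV: "openin (topo M) V" unfolding V_def
    using openin_continuous_map_preimage[OF cq chart_inj(3)[OF N d0(1)]]
      openin_continuous_map_preimage[OF cz chart_inj(3)[OF N e0(1)]] by blast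
  have pV: "p \<in> V" using p d0 e0 by (simp add: V_def)
  define E where "E = (\<lambda>x (v::'b tvec) f. v d0 * coord_vec N e0 (z x) f)"
  have at: "d0 \<in> charts_at N (q x)" "e0 \<in> charts_at N (z x)" if "x \<in> V" for x
    using that d0 e0 by (auto simp: V_def charts_at_def)
  have fib: "E x \<in> hom_fibre N q z x" if x: "x \<in> V" for x
  proof -
    have t: "coord_vec N e0 (z x) \<in> tangent_space N (z x)" using coord_vec_tangent[OF N at(2)[OF x]] .
    have "E x v \<in> tangent_space N (z x)" for v
      unfolding E_def by (rule tangent_space_scale[OF t])
    moreover have "E x (\<lambda>c. a * v c + b * w c) = (\<lambda>c. a * E x v c + b * E x w c)" for a b v w
      unfolding E_def by (rule ext) (simp add: algebra_simps)
    ultimately show ?thesis unfolding hom_fibre_def by blast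
  qed
  have nz: "\<exists>v\<in>tangent_space N (q x). E x v \<noteq> (\<lambda>_. 0)" if x: "x \<in> V" for x
  proof
    show "coord_vec N d0 (q x) \<in> tangent_space N (q x)" using coord_vec_tangent[OF N at(1)[OF x]] .
    have "E x (coord_vec N d0 (q x)) e0 = 1"
      using coord_vec_self[OF N at(1)[OF x]] coord_vec_self[OF N at(2)[OF x]] by (simp add: E_def)
    then show "E x (coord_vec N d0 (q x)) \<noteq> (\<lambda>_. 0)" by (metis zero_neq_one)
  qed
  have key: "(\<lambda>w. coord_vec N a (f (chart_inv c w)) b) holomorphic_on (snd c ` (fst c \<inter> S))"
    if f: "holomorphic_map M N f" and c: "c \<in> atlas M" and a: "a \<in> atlas N" and b: "b \<in> atlas N"
      and S: "S \<subseteq> f -` fst a \<inter> f -` fst b" for a b c f S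
  proof -
    let ?A = "snd c ` (fst c \<inter> S)"
    have inv: "chart_inv c (snd c x) = x" if "x \<in> fst c" for x using chart_inv[OF M c that] .
    have h1: "(snd a \<circ> f \<circ> chart_inv c) holomorphic_on ?A"
    proof (rule holomorphic_on_subset)
      show "(snd a \<circ> f \<circ> chart_inv c) holomorphic_on (snd c ` (fst c \<inter> f -` fst a))"
        using f c a unfolding holomorphic_map_def by blast
    qed (use S in auto)
    have "(snd b \<circ> chart_inv a) holomorphic_on (snd a ` (fst a \<inter> fst b))"
      using N a b unfolding riemann_surface_def by blast
    moreover have "open (snd a ` (fst a \<inter> fst b))"
      using charts_open[OF N a] chart_inj[OF N b] by blast
    ultimately have h2: "deriv (snd b \<circ> chart_inv a) holomorphic_on (snd a ` (fst a \<inter> fst b))"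
      by (rule holomorphic_deriv)
    have "(deriv (snd b \<circ> chart_inv a) \<circ> (snd a \<circ> f \<circ> chart_inv c)) holomorphic_on ?A"
      by (rule holomorphic_on_compose_gen[OF h1 h2]) (use S inv in auto)
    then show ?thesis
      by (rule holomorphic_transform) (use S inv b in \<open>auto simp: coord_vec_def charts_at_def\<close>)
  qed
  have hol: "(\<lambda>w. E (chart_inv c w) (coord_vec N d (q (chart_inv c w))) e)
          holomorphic_on (snd c ` (fst c \<inter> V \<inter> q -` fst d \<inter> z -` fst e))"
    if c: "c \<in> atlas M" and d: "d \<in> atlas N" and e: "e \<in> atlas N" for c d e
    unfolding E_def Int_assoc
    by (intro holomorphic_on_mult key[OF q c d d0(1)] key[OF z c e0(1) e]) (auto simp: V_def)
  have "holomorphic_frame M N q z V E"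
    unfolding holomorphic_frame_def by (intro conjI ballI fib nz hol oV)
  then show ?thesis using pV by blast
qed

end

theory Submission
  imports Defs
begin

text \<open>
  Write \<open>\<zeta>\<close> for \<open>z\<close> as a function of the coordinate \<open>q\<close>, so that \<open>H = \<bar>\<zeta>'\<bar>\<close>, and \<open>\<omega>'\<close> for
  the dual of \<open>\<omega>\<close>. Since
  \<open>ln \<bar>\<zeta>'\<bar>\<close> is the real part of a branch of \<open>log \<zeta>'\<close>, applying \<open>\<partial>\<^sub>q\<close> to it gives \<open>\<zeta>'' / (2 \<zeta>')\<close>
  (\<open>wirtinger_ln_norm\<close>). Hence \<open>- H \<omega> dq\<close> and \<open>(1/H) \<omega>' dz\<close> both equal \<open>i (\<zeta>''/\<zeta>') dq\<close>,
  and the dual conformal-net expression is \<open>2i dlog \<zeta>'\<close>. In the frame \<open>\<partial>/\<partial>z \<otimes> dq\<close> the section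
  \<open>\<Z> = Tz \<circ> (Tq)\<^sup>-\<^sup>1\<close> has the coefficient \<open>dz/dq = \<zeta>'\<close>, so the expression is the connection form
  \<open>\<Theta>\<close> in this frame (\<open>dual_net_form_eq_Theta\<close>). If \<open>E\<close> is another frame,
  with \<open>\<Z> = g E\<close> and \<open>E = h (\<partial>/\<partial>z \<otimes> dq)\<close>, then \<open>\<zeta>' = g h\<close>, and the gauge law turns
  \<open>2i dlog \<zeta>'\<close> into \<open>2i (dlog \<zeta>' - dlog h) = 2i dlog g\<close>
  (\<open>change_frame_dual_net_form\<close>).

  Near \<open>p\<close>, let \<open>E\<close> be a nowhere vanishing holomorphic frame. In a chart at \<open>p\<close> and charts of the target at
  \<open>q p\<close> and \<open>z p\<close>, the coefficient is \<open>g = A / (B C)\<close>, where \<open>A\<close> and \<open>B\<close> are the derivatives of the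
  coordinate expressions of \<open>z\<close> and \<open>q\<close>, and \<open>C\<close> is the coordinate expression of \<open>E\<close>, holomorphic
  without zeros. The zero orders of \<open>A\<close> and \<open>B\<close> at \<open>p\<close> are \<open>r\<^sub>z\<close> and \<open>r\<^sub>q\<close>, so \<open>g\<close> is meromorphic
  of order \<open>r\<^sub>z - r\<^sub>q\<close>, which is the residue of \<open>dlog g\<close> (\<open>logarithmic_connection_residue\<close>).
  That \<open>A\<close> and \<open>B\<close> do not vanish identically near \<open>p\<close> is part of the net expression being
  defined around \<open>p\<close>: on a net patch \<open>q\<close> is injective, hence unramified, and \<open>\<zeta>' \<noteq> 0\<close>.
\<close>

section \<open>Logarithmic derivatives in one complex variable\<close>

text \<open>If \<open>f = (w - a)\<^sup>n g\<close> with \<open>g\<close> holomorphic and \<open>g a \<noteq> 0\<close>, then \<open>f'/f = n/(w - a) + g'/g\<close>, and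
  the second summand is holomorphic at \<open>a\<close>.\<close>

lemma residue_logderiv:
  fixes f :: "complex \<Rightarrow> complex"
  assumes f: "f meromorphic_on {a}" and nz: "\<exists>\<^sub>F w in at a. f w \<noteq> 0"
  shows "residue (\<lambda>w. deriv f w / f w) a = of_int (zorder f a)"
proof -
  define n where "n = zorder f a"
  define g where "g = zor_poly f a"
  have iso: "isolated_singularity_at f a" and ness: "not_essential f a"
    using f meromorphic_on_isolated_singularity meromorphic_on_not_essential by auto
  obtain r where ga: "g a \<noteq> 0" and r: "r > 0" "g holomorphic_on cball a r"
    "\<And>w. w \<in> cball a r - {a} \<Longrightarrow> f w = g w * (w - a) powi n \<and> g w \<noteq> 0"
    using zorder_exist[OF iso ness nz] unfolding n_def g_def by blast
  have gh: "g holomorphic_on ball a r" using r(2) by (rule holomorphic_on_subset) auto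
  have gnz: "g w \<noteq> 0" if "w \<in> ball a r" for w using r(3)[of w] ga that by (cases "w = a") auto
  \<comment> \<open>The function \<open>(w - a) f'/f\<close>, extended over \<open>a\<close> by the value \<open>n\<close>, which is then the residue.\<close>
  define k where "k = (\<lambda>w. of_int n + (w - a) * (deriv g w / g w))"
  have kh: "k holomorphic_on ball a r"
    unfolding k_def using gh gnz by (intro holomorphic_intros) auto
  have ev: "\<forall>\<^sub>F w in at a. deriv f w / f w = k w / (w - a)"
  proof -
    have "deriv f w / f w = k w / (w - a)" if w: "w \<in> ball a r - {a}" for w
    proof -
      have d: "(g has_field_derivative deriv g w) (at w)"
        using gh w by (auto intro: holomorphic_derivI)
      have "((\<lambda>u. g u * (u - a) powi n) has_field_derivative
          g w * (of_int n * (w - a) powi (n - 1)) + deriv g w * (w - a) powi n) (at w)"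
        using w by (auto intro!: derivative_eq_intros d)
      moreover have "\<forall>\<^sub>F u in nhds w. g u * (u - a) powi n = f u"
        using w r(3) by (intro eventually_nhds_in_open[THEN eventually_mono, of "ball a r - {a}"]) auto
      ultimately have "(f has_field_derivative
          g w * (of_int n * (w - a) powi (n - 1)) + deriv g w * (w - a) powi n) (at w)"
        using DERIV_cong_ev by metis
      then have "deriv f w = g w * (of_int n * (w - a) powi (n - 1)) + deriv g w * (w - a) powi n"
        by (rule DERIV_imp_deriv)
      moreover have "f w = g w * (w - a) powi n" using r(3) w by auto
      moreover have "(w - a) powi n = (w - a) powi (n - 1) * (w - a)"
        using w power_int_add_1[of "w - a" "n - 1"] by auto
      ultimately show ?thesis
        using w gnz[of w] by (simp add: k_def divide_simps) (simp add: algebra_simps)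
    qed
    then show ?thesis
      using r(1) eventually_at_in_open[of "ball a r" a] by (auto elim!: eventually_mono)
  qed
  have "residue (\<lambda>w. deriv f w / f w) a = residue (\<lambda>w. k w / (w - a)) a"
    by (rule residue_cong[OF ev refl])
  also have "\<dots> = k a" using r(1) by (intro residue_simple[OF _ _ kh]) auto
  finally show ?thesis by (simp add: k_def n_def)
qed

lemma residue_logderiv_quotient:
  fixes A B C :: "complex \<Rightarrow> complex"
  assumes S: "open S" "a \<in> S"
    and hol: "A holomorphic_on S" "B holomorphic_on S" "C holomorphic_on S"
    and nz: "\<And>w. w \<in> S - {a} \<Longrightarrow> A w \<noteq> 0" "\<And>w. w \<in> S - {a} \<Longrightarrow> B w \<noteq> 0" "\<And>w. w \<in> S \<Longrightarrow> C w \<noteq> 0"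
  defines "g \<equiv> \<lambda>w. A w / (B w * C w)"
  shows "g meromorphic_on {a}"
    and "residue (\<lambda>w. k * (deriv g w / g w)) a = k * (of_int (zorder A a) - of_int (zorder B a))"
proof -
  have an: "A analytic_on {a}" "B analytic_on {a}" "C analytic_on {a}"
    using hol S analytic_at by blast+
  then have mer: "A meromorphic_on {a}" "(\<lambda>w. B w * C w) meromorphic_on {a}"
    by (auto intro!: analytic_on_imp_meromorphic_on analytic_intros)
  then show gm: "g meromorphic_on {a}"
    unfolding g_def by (rule meromorphic_on_divide)
  have ev: "\<forall>\<^sub>F w in at a. w \<in> S - {a}" using eventually_at_in_open[OF S] .
  have fr: "\<exists>\<^sub>F w in at a. P w" if "\<And>w. w \<in> S - {a} \<Longrightarrow> P w" for P
    using eventually_mono[OF ev that] by (intro eventually_frequently) auto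
  have "zorder g a = zorder A a - zorder (\<lambda>w. B w * C w) a"
    unfolding g_def using nz by (intro zorder_divide mer fr) auto
  also have "zorder (\<lambda>w. B w * C w) a = zorder B a + zorder C a"
    using nz by (intro zorder_times_analytic an eventually_mono[OF ev]) auto
  also have "zorder C a = 0" using an(3) nz(3) S by (intro zorder_eq_0I) auto
  finally have z: "zorder g a = zorder A a - zorder B a" by simp
  have "g holomorphic_on S - {a}"
    unfolding g_def using nz
    by (intro holomorphic_intros holomorphic_on_subset[OF hol(1)] holomorphic_on_subset[OF hol(2)]
        holomorphic_on_subset[OF hol(3)]) auto
  then have "(\<lambda>w. deriv g w / g w) holomorphic_on S - {a}"
    using S nz by (intro holomorphic_intros) (auto simp: g_def)
  then have "residue (\<lambda>w. k * (deriv g w / g w)) a = k * residue (\<lambda>w. deriv g w / g w) a"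
    by (rule residue_lmul[OF S])
  also have "residue (\<lambda>w. deriv g w / g w) a = of_int (zorder g a)"
    using nz by (intro residue_logderiv gm fr) (auto simp: g_def)
  finally show "residue (\<lambda>w. k * (deriv g w / g w)) a = k * (of_int (zorder A a) - of_int (zorder B a))"
    by (simp add: z)
qed

text \<open>Locally \<open>ln \<bar>h\<bar>\<close> is the real part of \<open>log h\<close>, and \<open>(\<partial>\<^sub>1 - i \<partial>\<^sub>2)/2\<close> maps the real part of a
  holomorphic function to half its derivative. No branch of the logarithm is chosen: the
  derivative of \<open>ln \<bar>h\<bar>\<close> in a direction \<open>c\<close> is \<open>Re (c h'/h)\<close>, which is used for \<open>c = 1\<close> and \<open>c = i\<close>.\<close>

lemma wirtinger_ln_norm:
  assumes h: "h field_differentiable at a" and nz: "h a \<noteq> 0"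
  shows "wirtinger (\<lambda>u. of_real (ln (norm (h u)))) a = deriv h a / (2 * h a)"
proof -
  have vd: "((\<lambda>t::real. complex_of_real (ln (norm (h (a + c * of_real t)))))
       has_vector_derivative of_real (Re (c * (deriv h a / h a)))) (at 0)" for c
  proof -
    have "((\<lambda>t::real. h (a + c * of_real t)) has_vector_derivative c * deriv h a) (at 0)"
    proof (rule field_vector_diff_chain_at[of "\<lambda>t::real. a + c * of_real t" c 0 h "deriv h a", unfolded o_def])
      have "((\<lambda>t::real. c * of_real t) has_vector_derivative c * 1) (at 0)"
        by (intro derivative_intros has_vector_derivative_of_real) (auto intro!: derivative_eq_intros)
      then show "((\<lambda>t::real. a + c * of_real t) has_vector_derivative c) (at 0)"
        using has_vector_derivative_add[OF has_vector_derivative_const] by fastforce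
      show "(h has_field_derivative deriv h a) (at (a + c * complex_of_real 0))"
        using h by (simp add: field_differentiable_derivI)
    qed
    then have D: "((\<lambda>t::real. h (a + c * of_real t)) has_derivative (\<lambda>t. t *\<^sub>R (c * deriv h a))) (at 0)"
      by (simp add: has_vector_derivative_def)
    have "((\<lambda>t::real. norm (h (a + c * of_real t))) has_derivative
        (\<lambda>t. (t *\<^sub>R (c * deriv h a)) \<bullet> sgn (h a))) (at 0)"
    proof -
      have "(norm has_derivative (\<lambda>y. y \<bullet> sgn (h a))) (at (h (a + c * of_real 0)))"
        using has_derivative_norm[OF nz] by simp
      from has_derivative_compose[OF D this] show ?thesis by simp
    qed
    then have "((\<lambda>t::real. norm (h (a + c * of_real t))) has_real_derivative
        ((c * deriv h a) \<bullet> sgn (h a))) (at 0)"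
      by (simp add: has_field_derivative_def mult_commute_abs)
    then have "((\<lambda>t::real. ln (norm (h (a + c * of_real t)))) has_real_derivative
        ((c * deriv h a) \<bullet> sgn (h a)) / norm (h a)) (at 0)"
      using nz by (auto intro!: derivative_eq_intros)
    moreover have "((c * deriv h a) \<bullet> sgn (h a)) / norm (h a) = Re (c * (deriv h a / h a))"
      by (simp add: inner_complex_def sgn_eq complex_div_cnj[of "deriv h a" "h a"]
          complex_div_cnj[of "c * deriv h a" "h a"] power2_eq_square field_simps
          flip: add_divide_distrib diff_divide_distrib)
    ultimately show ?thesis by (auto intro: has_vector_derivative_of_real)
  qed
  have "vector_derivative (\<lambda>t::real. complex_of_real (ln (norm (h (a + of_real t))))) (at 0)
      = of_real (Re (deriv h a / h a))"
    using vector_derivative_at[OF vd[of 1]] by simp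
  moreover have "vector_derivative (\<lambda>t::real. complex_of_real (ln (norm (h (a + \<i> * of_real t))))) (at 0)
      = of_real (- Im (deriv h a / h a))"
    using vector_derivative_at[OF vd[of \<i>]] by (simp add: times_divide_eq_right[symmetric] del: times_divide_eq_right)
  ultimately have "wirtinger (\<lambda>u. of_real (ln (norm (h u)))) a
      = (of_real (Re (deriv h a / h a)) + \<i> * of_real (Im (deriv h a / h a))) / 2"
    unfolding wirtinger_def by simp
  also have "\<dots> = deriv h a / h a / 2" by (simp only: complex_eq[symmetric])
  finally show ?thesis by simp
qed

section \<open>Tangent vectors and differentials in charts\<close>

lemma chart_at_in: "riemann_surface M \<Longrightarrow> x \<in> points M \<Longrightarrow> chart_at M x \<in> charts_at M x"
proof -
  assume "riemann_surface M" "x \<in> points M"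
  then have "\<exists>c. c \<in> charts_at M x" unfolding riemann_surface_def charts_at_def by blast
  then show ?thesis unfolding chart_at_def by (rule someI_ex)
qed

lemma charts_at_points: "riemann_surface M \<Longrightarrow> c \<in> charts_at M x \<Longrightarrow> x \<in> points M"
  using chart_inj(2)[of M c] by (auto simp: charts_at_def)

text \<open>Tangent spaces are complex lines, spanned by the coordinate vector of any chart. Every
  comparison of tangent vectors below is thereby a comparison of one component.\<close>

lemma tangent_vector_eq_scale:
  assumes "v \<in> tangent_space M x" "c \<in> charts_at M x"
  shows "v = (\<lambda>d. v c * coord_vec M c x d)"
proof
  fix d
  show "v d = v c * coord_vec M c x d"
  proof (cases "d \<in> charts_at M x")
    case True
    then have "v d = deriv (snd d \<circ> chart_inv c) (snd c x) * v c"
      using assms unfolding tangent_space_def by blast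
    then show ?thesis using True unfolding coord_vec_def by simp
  next
    case False
    then have "v d = 0" using assms unfolding tangent_space_def by blast
    then show ?thesis using False by (simp add: coord_vec_def)
  qed
qed

lemma tangent_space_lincomb:
  assumes v: "v \<in> tangent_space M x" and w: "w \<in> tangent_space M x"
  shows "(\<lambda>c. a * v c + b * w c) \<in> tangent_space M x"
  unfolding tangent_space_def
proof (intro CollectI conjI ballI allI impI)
  fix c d assume "c \<in> charts_at M x" "d \<in> charts_at M x"
  then have "v d = deriv (snd d \<circ> chart_inv c) (snd c x) * v c"
    "w d = deriv (snd d \<circ> chart_inv c) (snd c x) * w c"
    using v w unfolding tangent_space_def by blast+
  then show "a * v d + b * w d = deriv (snd d \<circ> chart_inv c) (snd c x) * (a * v c + b * w c)"
    by (metis distrib_left mult.left_commute)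
next
  fix c assume "c \<notin> charts_at M x"
  then have "v c = 0" "w c = 0" using v w unfolding tangent_space_def by blast+
  then show "a * v c + b * w c = 0" by simp
qed

lemma tangent_vector_eqI:
  assumes "v \<in> tangent_space M x" "w \<in> tangent_space M x" "c \<in> charts_at M x" "v c = w c"
  shows "v = w"
proof -
  have "v = (\<lambda>d. v c * coord_vec M c x d)" by (rule tangent_vector_eq_scale[OF assms(1,3)])
  also have "\<dots> = (\<lambda>d. w c * coord_vec M c x d)" unfolding assms(4) ..
  also have "\<dots> = w" by (rule tangent_vector_eq_scale[OF assms(2,3), symmetric])
  finally show ?thesis .
qed

text \<open>The operators \<open>fun_d\<close>, \<open>dlog\<close> and \<open>differential\<close> are computed in an arbitrarily chosen chart that varies
  with the point. The chain rule in the following form lets them be computed in a fixed chart.\<close>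

lemma deriv_chart_change:
  assumes M: "riemann_surface M" and c: "c \<in> charts_at M x" and d: "d \<in> charts_at M x"
    and g: "(g \<circ> chart_inv c) field_differentiable at (snd c x)"
  shows "deriv (g \<circ> chart_inv d) (snd d x) * deriv (snd d \<circ> chart_inv c) (snd c x)
    = deriv (g \<circ> chart_inv c) (snd c x)"
proof -
  have c': "c \<in> atlas M" "x \<in> fst c" and d': "d \<in> atlas M" "x \<in> fst d"
    using c d by (auto simp: charts_at_def)
  have inv: "chart_inv d (snd d x) = x" using chart_inv[OF M d'] .
  have o: "open (snd d ` (fst d \<inter> fst c))"
    using charts_open[OF M d'(1)] chart_inj(3)[OF M c'(1)] by blast
  have "deriv (g \<circ> chart_inv d) (snd d x)
      = deriv ((g \<circ> chart_inv c) \<circ> (snd c \<circ> chart_inv d)) (snd d x)"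
  proof (rule deriv_cong_ev)
    show "\<forall>\<^sub>F w in nhds (snd d x). (g \<circ> chart_inv d) w = ((g \<circ> chart_inv c) \<circ> (snd c \<circ> chart_inv d)) w"
      unfolding eventually_nhds
      using o c' d' chart_inv[OF M c'(1)] chart_inv[OF M d'(1)]
      by (intro exI[of _ "snd d ` (fst d \<inter> fst c)"]) auto
  qed auto
  also have "\<dots> = deriv (g \<circ> chart_inv c) ((snd c \<circ> chart_inv d) (snd d x))
      * deriv (snd c \<circ> chart_inv d) (snd d x)"
    using trans_diff[OF M d c] g inv by (intro deriv_chain) auto
  finally have "deriv (g \<circ> chart_inv d) (snd d x)
      = deriv (g \<circ> chart_inv c) (snd c x) * deriv (snd c \<circ> chart_inv d) (snd d x)"
    using inv by simp
  moreover have "deriv (snd c \<circ> chart_inv d) (snd d x) * deriv (snd d \<circ> chart_inv c) (snd c x) = 1"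
    using trans_cocycle[OF M c d c] coord_vec_self[OF M c] c unfolding coord_vec_def by simp
  ultimately show ?thesis by (metis mult.assoc mult.right_neutral)
qed

lemma fun_d_in_chart:
  assumes M: "riemann_surface M" and c: "c \<in> charts_at M x" and v: "v \<in> tangent_space M x"
    and g: "(g \<circ> chart_inv c) field_differentiable at (snd c x)"
  shows "fun_d M g x v = deriv (g \<circ> chart_inv c) (snd c x) * v c"
proof -
  let ?d = "chart_at M x"
  have d: "?d \<in> charts_at M x" using chart_at_in[OF M charts_at_points[OF M c]] .
  have "v ?d = deriv (snd ?d \<circ> chart_inv c) (snd c x) * v c"
    using v c d unfolding tangent_space_def by blast
  then show ?thesis unfolding fun_d_def
    using deriv_chart_change[OF M c d g] by (metis mult.assoc)
qed

lemma dlog_in_chart: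
  assumes "riemann_surface M" "c \<in> charts_at M x" "v \<in> tangent_space M x"
    and "(g \<circ> chart_inv c) field_differentiable at (snd c x)"
  shows "dlog M g x v = deriv (g \<circ> chart_inv c) (snd c x) / g x * v c"
  unfolding dlog_def using fun_d_in_chart[OF assms] by (simp add: divide_inverse)

lemma eventually_chart:
  assumes M: "riemann_surface M" and c: "c \<in> charts_at M x" and W: "openin (topo M) W" "x \<in> W"
    and P: "\<And>y. y \<in> fst c \<inter> W \<Longrightarrow> P (snd c y)"
  shows "\<forall>\<^sub>F w in nhds (snd c x). P w"
  unfolding eventually_nhds
  using charts_open[OF M _ W(1), of c] c W(2) P
  by (intro exI[of _ "snd c ` (fst c \<inter> W)"]) (auto simp: charts_at_def)

text \<open>Transfers a formula for \<open>g\<close> in the coordinate of \<open>c\<close>, valid near \<open>x\<close>, to the derivative of the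
  coordinate expression of \<open>g\<close>. The agreement has to hold on a neighbourhood of \<open>x\<close> in the surface, since
  frame coefficients satisfy their formulas only where \<open>q\<close> is unramified.\<close>

lemma field_differentiable_cong_chart:
  assumes M: "riemann_surface M" and c: "c \<in> charts_at M x" and W: "openin (topo M) W" "x \<in> W"
    and eq: "\<And>y. y \<in> fst c \<inter> W \<Longrightarrow> g y = k (snd c y)"
    and k: "k field_differentiable at (snd c x)"
  shows "(g \<circ> chart_inv c) field_differentiable at (snd c x)"
    and "deriv (g \<circ> chart_inv c) (snd c x) = deriv k (snd c x)"
proof -
  have ca: "c \<in> atlas M" using c by (auto simp: charts_at_def)
  have ev: "\<forall>\<^sub>F w in nhds (snd c x). (g \<circ> chart_inv c) w = k w"
    by (rule eventually_chart[OF M c W]) (use eq chart_inv[OF M ca] in auto)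
  have "(k has_field_derivative deriv k (snd c x)) (at (snd c x))"
    using k field_differentiable_derivI by blast
  then have D: "((g \<circ> chart_inv c) has_field_derivative deriv k (snd c x)) (at (snd c x))"
    using DERIV_cong_ev[OF refl ev refl] by blast
  then show "(g \<circ> chart_inv c) field_differentiable at (snd c x)"
    "deriv (g \<circ> chart_inv c) (snd c x) = deriv k (snd c x)"
    using field_differentiable_def DERIV_imp_deriv by blast+
qed

lemma dlog_mult:
  assumes M: "riemann_surface M" and c: "c \<in> charts_at M x" and v: "v \<in> tangent_space M x"
    and W: "openin (topo M) W" "x \<in> W"
    and eq: "\<And>y. y \<in> W \<Longrightarrow> g y = h y * k y"
    and h: "(h \<circ> chart_inv c) field_differentiable at (snd c x)" "h x \<noteq> 0"
    and k: "(k \<circ> chart_inv c) field_differentiable at (snd c x)" "k x \<noteq> 0"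
  shows "dlog M g x v = dlog M h x v + dlog M k x v"
proof -
  have ca: "c \<in> atlas M" "x \<in> fst c" using c by (auto simp: charts_at_def)
  let ?hk = "\<lambda>w. (h \<circ> chart_inv c) w * (k \<circ> chart_inv c) w"
  have fd: "?hk field_differentiable at (snd c x)"
    using h(1) k(1) by (rule field_differentiable_mult)
  have "\<And>y. y \<in> fst c \<inter> W \<Longrightarrow> g y = ?hk (snd c y)"
    using eq chart_inv[OF M ca(1)] by simp
  note g = field_differentiable_cong_chart[OF M c W this fd]
  have "deriv ?hk (snd c x) = h x * deriv (k \<circ> chart_inv c) (snd c x)
      + deriv (h \<circ> chart_inv c) (snd c x) * k x"
    using deriv_mult[OF h(1) k(1)] chart_inv[OF M ca] by simp
  with g(2) eq[OF W(2)] have "deriv (g \<circ> chart_inv c) (snd c x) / g x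
      = deriv (h \<circ> chart_inv c) (snd c x) / h x + deriv (k \<circ> chart_inv c) (snd c x) / k x"
    using h(2) k(2) by (simp add: field_simps)
  moreover have "dlog M g x v = deriv (g \<circ> chart_inv c) (snd c x) / g x * v c"
    by (rule dlog_in_chart[OF M c v g(1)])
  moreover have "dlog M h x v = deriv (h \<circ> chart_inv c) (snd c x) / h x * v c"
    by (rule dlog_in_chart[OF M c v h(1)])
  moreover have "dlog M k x v = deriv (k \<circ> chart_inv c) (snd c x) / k x * v c"
    by (rule dlog_in_chart[OF M c v k(1)])
  ultimately show ?thesis by (simp add: distrib_right)
qed

definition coord_deriv :: "('a \<Rightarrow> 'b) \<Rightarrow> 'a chart \<Rightarrow> 'b chart \<Rightarrow> 'a \<Rightarrow> complex" where
  "coord_deriv f c d x = deriv (snd d \<circ> f \<circ> chart_inv c) (snd c x)"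

lemma holomorphic_map_points:
  "holomorphic_map M N f \<Longrightarrow> x \<in> points M \<Longrightarrow> f x \<in> points N"
  unfolding holomorphic_map_def continuous_map_def by blast

lemma holomorphic_map_in_charts:
  assumes M: "riemann_surface M" and N: "riemann_surface N" and f: "holomorphic_map M N f"
    and c: "c \<in> atlas M" and d: "d \<in> atlas N"
  shows "open (snd c ` (fst c \<inter> f -` fst d))"
    and "(snd d \<circ> f \<circ> chart_inv c) holomorphic_on (snd c ` (fst c \<inter> f -` fst d))"
proof -
  have "openin (topo M) {x \<in> points M. f x \<in> fst d}"
    using f openin_continuous_map_preimage[OF _ chart_inj(3)[OF N d]]
    unfolding holomorphic_map_def by blast
  moreover have "fst c \<inter> {x \<in> points M. f x \<in> fst d} = fst c \<inter> f -` fst d"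
    using chart_inj(2)[OF M c] by auto
  ultimately show "open (snd c ` (fst c \<inter> f -` fst d))" using charts_open[OF M c] by metis
qed (use f c d in \<open>auto simp: holomorphic_map_def\<close>)

lemma coord_map_differentiable:
  assumes "riemann_surface M" "riemann_surface N" "holomorphic_map M N f"
    and "c \<in> charts_at M x" "d \<in> charts_at N (f x)"
  shows "(snd d \<circ> f \<circ> chart_inv c) field_differentiable at (snd c x)"
  using holomorphic_map_in_charts[OF assms(1-3), of c d] assms(4,5) holomorphic_on_imp_differentiable_at
  by (fastforce simp: charts_at_def)

lemma differential_in_charts:
  assumes M: "riemann_surface M" and N: "riemann_surface N" and f: "holomorphic_map M N f"
    and c: "c \<in> charts_at M x" and d: "d \<in> charts_at N (f x)" and v: "v \<in> tangent_space M x"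
  shows "differential M N f x v d = coord_deriv f c d x * v c"
  using fun_d_in_chart[OF M c v coord_map_differentiable[OF M N f c d]] d
  unfolding differential_def fun_d_def coord_deriv_def by simp

lemma coord_deriv_target_change:
  assumes M: "riemann_surface M" and N: "riemann_surface N" and f: "holomorphic_map M N f"
    and c: "c \<in> charts_at M x" and d: "d \<in> charts_at N (f x)" and e: "e \<in> charts_at N (f x)"
  shows "coord_deriv f c e x = deriv (snd e \<circ> chart_inv d) (snd d (f x)) * coord_deriv f c d x"
proof -
  have ca: "c \<in> atlas M" "x \<in> fst c" and da: "d \<in> atlas N" "f x \<in> fst d"
    using c d by (auto simp: charts_at_def)
  have inv: "chart_inv c (snd c x) = x" using chart_inv[OF M ca] .
  have "coord_deriv f c e x = deriv ((snd e \<circ> chart_inv d) \<circ> (snd d \<circ> f \<circ> chart_inv c)) (snd c x)"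
    unfolding coord_deriv_def
  proof (rule deriv_cong_ev)
    show "\<forall>\<^sub>F w in nhds (snd c x).
        (snd e \<circ> f \<circ> chart_inv c) w = ((snd e \<circ> chart_inv d) \<circ> (snd d \<circ> f \<circ> chart_inv c)) w"
      unfolding eventually_nhds
      using holomorphic_map_in_charts(1)[OF M N f ca(1) da(1)] ca da
        chart_inv[OF M ca(1)] chart_inv[OF N da(1)]
      by (intro exI[of _ "snd c ` (fst c \<inter> f -` fst d)"]) auto
  qed auto
  also have "\<dots> = deriv (snd e \<circ> chart_inv d) ((snd d \<circ> f \<circ> chart_inv c) (snd c x)) * coord_deriv f c d x"
    unfolding coord_deriv_def
    using coord_map_differentiable[OF M N f c d] trans_diff[OF N d e] inv by (intro deriv_chain) auto
  finally show ?thesis using inv by simp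
qed

lemma differential_tangent:
  assumes M: "riemann_surface M" and N: "riemann_surface N" and f: "holomorphic_map M N f"
    and x: "x \<in> points M" and v: "v \<in> tangent_space M x"
  shows "differential M N f x v \<in> tangent_space N (f x)"
  unfolding tangent_space_def
proof (intro CollectI conjI ballI allI impI)
  have c: "chart_at M x \<in> charts_at M x" using chart_at_in[OF M x] .
  fix d e assume d: "d \<in> charts_at N (f x)" and e: "e \<in> charts_at N (f x)"
  show "differential M N f x v e = deriv (snd e \<circ> chart_inv d) (snd d (f x)) * differential M N f x v d"
    unfolding differential_in_charts[OF M N f c d v] differential_in_charts[OF M N f c e v]
    using coord_deriv_target_change[OF M N f c d e] by simp
qed (simp add: differential_def)

section \<open>Homomorphisms between tangent lines and frame coefficients\<close>

text \<open>A homomorphism between two complex lines is a \<open>1 \<times> 1\<close> matrix: its single entry, relative to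
  \<open>\<partial>/\<partial>d\<close> and \<open>\<partial>/\<partial>e\<close>, is the \<open>e\<close>-component of the image of \<open>\<partial>/\<partial>d\<close>.\<close>

lemma hom_fibre_in_charts:
  assumes N: "riemann_surface N" and d: "d \<in> charts_at N (q x)" and e: "e \<in> charts_at N (z x)"
    and L: "L \<in> hom_fibre N q z x" and v: "v \<in> tangent_space N (q x)"
  shows "L v = (\<lambda>e'. L (coord_vec N d (q x)) e * v d * coord_vec N e (z x) e')"
proof -
  let ?D = "coord_vec N d (q x)"
  have D: "?D \<in> tangent_space N (q x)" using coord_vec_tangent[OF N d] .
  have "L v = L (\<lambda>c. v d * ?D c + 0 * ?D c)" using tangent_vector_eq_scale[OF v d] by simp
  also have "\<dots> = (\<lambda>c. v d * L ?D c + 0 * L ?D c)"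
    using L D unfolding hom_fibre_def by blast
  finally have 1: "L v = (\<lambda>c. v d * L ?D c)" by simp
  have "L ?D \<in> tangent_space N (z x)" using L D unfolding hom_fibre_def by blast
  then have 2: "L ?D = (\<lambda>e'. L ?D e * coord_vec N e (z x) e')" using e by (rule tangent_vector_eq_scale)
  show ?thesis
  proof
    fix e'
    have "L v e' = v d * L ?D e'" using 1 by (rule fun_cong)
    also have "L ?D e' = L ?D e * coord_vec N e (z x) e'" using 2 by (rule fun_cong)
    finally show "L v e' = L ?D e * v d * coord_vec N e (z x) e'" by simp
  qed
qed

lemma hom_fibreI:
  assumes N: "riemann_surface N" and e: "e \<in> charts_at N (z x)"
    and L: "\<And>v. v \<in> tangent_space N (q x) \<Longrightarrow> L v = (\<lambda>e'. a * v d * coord_vec N e (z x) e')"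
  shows "L \<in> hom_fibre N q z x"
  unfolding hom_fibre_def
proof (intro CollectI conjI ballI allI)
  fix v w a' b assume v: "v \<in> tangent_space N (q x)" and w: "w \<in> tangent_space N (q x)"
  have "(\<lambda>c. a' * v c + b * w c) \<in> tangent_space N (q x)"
    by (rule tangent_space_lincomb[OF v w])
  then show "L (\<lambda>c. a' * v c + b * w c) = (\<lambda>c. a' * L v c + b * L w c)"
    using L v w by (simp add: algebra_simps)
next
  fix v assume "v \<in> tangent_space N (q x)"
  then show "L v \<in> tangent_space N (z x)"
    using L tangent_space_scale[OF coord_vec_tangent[OF N e]] by simp
qed

lemma frame_coeff_in_charts:
  assumes N: "riemann_surface N" and d: "d \<in> charts_at N (q x)" and e: "e \<in> charts_at N (z x)"
    and S: "S x \<in> hom_fibre N q z x" and E: "E x \<in> hom_fibre N q z x"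
    and nz: "E x (coord_vec N d (q x)) e \<noteq> 0"
  shows "frame_coeff N q S E x = S x (coord_vec N d (q x)) e / E x (coord_vec N d (q x)) e"
  unfolding frame_coeff_def
proof (rule the_equality)
  show "\<forall>v\<in>tangent_space N (q x).
      S x v = (\<lambda>e'. S x (coord_vec N d (q x)) e / E x (coord_vec N d (q x)) e * E x v e')"
  proof
    fix v assume v: "v \<in> tangent_space N (q x)"
    show "S x v = (\<lambda>e'. S x (coord_vec N d (q x)) e / E x (coord_vec N d (q x)) e * E x v e')"
      using hom_fibre_in_charts[where q=q and z=z and x=x, OF N d e S v]
        hom_fibre_in_charts[where q=q and z=z and x=x, OF N d e E v] nz by (simp add: mult.assoc)
  qed
next
  fix g assume "\<forall>v\<in>tangent_space N (q x). S x v = (\<lambda>e. g * E x v e)"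
  then have "S x (coord_vec N d (q x)) = (\<lambda>e. g * E x (coord_vec N d (q x)) e)"
    using coord_vec_tangent[OF N d] by blast
  then have "S x (coord_vec N d (q x)) e = g * E x (coord_vec N d (q x)) e" by (rule fun_cong)
  then show "g = S x (coord_vec N d (q x)) e / E x (coord_vec N d (q x)) e" using nz by simp
qed

text \<open>The inverse of \<open>Tq\<close> is taken through \<open>inv_into\<close>, so some preimage of \<open>v\<close> has to be exhibited first; its
  component is then forced by \<open>v\<close>, since \<open>Tq\<close> multiplies components by a nonzero number.\<close>

lemma relative_morphism_in_charts:
  assumes M: "riemann_surface M" and N: "riemann_surface N"
    and q: "holomorphic_map M N q" and z: "holomorphic_map M N z"
    and c: "c \<in> charts_at M x" and d: "d \<in> charts_at N (q x)" and e: "e \<in> charts_at N (z x)"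
    and nz: "coord_deriv q c d x \<noteq> 0" and v: "v \<in> tangent_space N (q x)"
  shows "relative_morphism M N q z x v =
    (\<lambda>e'. coord_deriv z c e x / coord_deriv q c d x * v d * coord_vec N e (z x) e')"
proof -
  have x: "x \<in> points M" using charts_at_points[OF M c] .
  let ?B = "coord_deriv q c d x"
  define u0 where "u0 = (\<lambda>c'. (v d / ?B) * coord_vec M c x c')"
  have u0: "u0 \<in> tangent_space M x" unfolding u0_def
    by (rule tangent_space_scale[OF coord_vec_tangent[OF M c]])
  have "u0 c = v d / ?B" unfolding u0_def using coord_vec_self[OF M c] by simp
  then have "differential M N q x u0 d = v d"
    using differential_in_charts[OF M N q c d u0] nz by simp
  then have "differential M N q x u0 = v"
    by (rule tangent_vector_eqI[OF differential_tangent[OF M N q x u0] v d])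
  then have im: "v \<in> differential M N q x ` tangent_space M x" using u0 by blast
  define u where "u = inv_into (tangent_space M x) (differential M N q x) v"
  have u: "u \<in> tangent_space M x" "differential M N q x u = v"
    unfolding u_def using inv_into_into[OF im] f_inv_into_f[OF im] by auto
  have "v d = ?B * u c" using differential_in_charts[OF M N q c d u(1)] u(2) by simp
  then have uc: "u c = v d / ?B" using nz by simp
  have "relative_morphism M N q z x v = differential M N z x u"
    by (simp add: relative_morphism_def u_def)
  moreover have "differential M N z x u e = coord_deriv z c e x / ?B * v d"
    using differential_in_charts[OF M N z c e u(1)] uc by simp
  moreover have "differential M N z x u = (\<lambda>e'. differential M N z x u e * coord_vec N e (z x) e')"
    by (rule tangent_vector_eq_scale[OF differential_tangent[OF M N z x u(1)] e])
  ultimately show ?thesis by (simp only:)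
qed

lemma frame_coeff_relative_morphism:
  assumes M: "riemann_surface M" and N: "riemann_surface N"
    and q: "holomorphic_map M N q" and z: "holomorphic_map M N z"
    and c: "c \<in> charts_at M x" and d: "d \<in> charts_at N (q x)" and e: "e \<in> charts_at N (z x)"
    and nz: "coord_deriv q c d x \<noteq> 0"
    and E: "E x \<in> hom_fibre N q z x" and Enz: "E x (coord_vec N d (q x)) e \<noteq> 0"
  shows "frame_coeff N q (relative_morphism M N q z) E x =
    coord_deriv z c e x / (coord_deriv q c d x * E x (coord_vec N d (q x)) e)"
proof -
  note R = relative_morphism_in_charts[OF M N q z c d e nz]
  have "relative_morphism M N q z x \<in> hom_fibre N q z x"
    by (rule hom_fibreI[where q=q and z=z and x=x, OF N e R])
  moreover have "relative_morphism M N q z x (coord_vec N d (q x)) e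
      = coord_deriv z c e x / coord_deriv q c d x"
    using R[OF coord_vec_tangent[OF N d]] coord_vec_self[OF N d] coord_vec_self[OF N e] by simp
  ultimately show ?thesis using frame_coeff_in_charts[where q=q and z=z and x=x and S = "relative_morphism M N q z" and E=E,
        OF N d e _ E Enz] by simp
qed

lemma holomorphic_frame_in_charts:
  assumes N: "riemann_surface N" and d: "d \<in> charts_at N (q x)" and e: "e \<in> charts_at N (z x)"
    and E: "holomorphic_frame M N q z V E" and x: "x \<in> V"
  shows "E x \<in> hom_fibre N q z x" "E x (coord_vec N d (q x)) e \<noteq> 0"
proof -
  show F: "E x \<in> hom_fibre N q z x" using E x unfolding holomorphic_frame_def by blast
  obtain v where v: "v \<in> tangent_space N (q x)" "E x v \<noteq> (\<lambda>_. 0)"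
    using E x unfolding holomorphic_frame_def by blast
  show "E x (coord_vec N d (q x)) e \<noteq> 0"
    using hom_fibre_in_charts[where q=q and z=z and x=x, OF N d e F v(1)] v(2) by auto
qed

lemma frame_entry_holomorphic:
  assumes M: "riemann_surface M" and N: "riemann_surface N"
    and q: "holomorphic_map M N q" and z: "holomorphic_map M N z"
    and c: "c \<in> atlas M" and d: "d \<in> atlas N" and e: "e \<in> atlas N"
    and E: "holomorphic_frame M N q z V E"
  defines "S \<equiv> snd c ` (fst c \<inter> V \<inter> q -` fst d \<inter> z -` fst e)"
  shows "open S"
    and "deriv (snd d \<circ> q \<circ> chart_inv c) holomorphic_on S"
    and "deriv (snd e \<circ> z \<circ> chart_inv c) holomorphic_on S"
    and "(\<lambda>w. E (chart_inv c w) (coord_vec N d (q (chart_inv c w))) e) holomorphic_on S"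
proof -
  have oV: "openin (topo M) V" using E unfolding holomorphic_frame_def by blast
  let ?Q = "snd c ` (fst c \<inter> q -` fst d)" and ?Z = "snd c ` (fst c \<inter> z -` fst e)"
  have inj: "inj_on (snd c) (fst c)" using chart_inj(1)[OF M c] .
  have S: "S = snd c ` (fst c \<inter> V) \<inter> ?Q \<inter> ?Z"
    unfolding S_def using inj unfolding inj_on_def by blast
  note Q = holomorphic_map_in_charts[OF M N q c d] and Z = holomorphic_map_in_charts[OF M N z c e]
  show "open S" unfolding S using Q(1) Z(1) charts_open[OF M c oV] by blast
  show "deriv (snd d \<circ> q \<circ> chart_inv c) holomorphic_on S"
    using holomorphic_deriv[OF Q(2,1)] by (rule holomorphic_on_subset) (auto simp: S)
  show "deriv (snd e \<circ> z \<circ> chart_inv c) holomorphic_on S"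
    using holomorphic_deriv[OF Z(2,1)] by (rule holomorphic_on_subset) (auto simp: S)
  show "(\<lambda>w. E (chart_inv c w) (coord_vec N d (q (chart_inv c w))) e) holomorphic_on S"
    using E c d e unfolding holomorphic_frame_def S_def by blast
qed

text \<open>The coordinate expression of the function \<open>g\<close> with \<open>\<Z> = g E\<close>.\<close>

definition relative_quotient ::
    "'b surface \<Rightarrow> ('a \<Rightarrow> 'b) \<Rightarrow> ('a \<Rightarrow> 'b) \<Rightarrow> ('a, 'b) hom_section \<Rightarrow>
      'a chart \<Rightarrow> 'b chart \<Rightarrow> 'b chart \<Rightarrow> complex \<Rightarrow> complex" where
  "relative_quotient N q z E c d e w =
     deriv (snd e \<circ> z \<circ> chart_inv c) w /
     (deriv (snd d \<circ> q \<circ> chart_inv c) w * E (chart_inv c w) (coord_vec N d (q (chart_inv c w))) e)"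

lemma frame_coeff_relative_quotient:
  assumes M: "riemann_surface M" and N: "riemann_surface N"
    and q: "holomorphic_map M N q" and z: "holomorphic_map M N z"
    and c: "c \<in> charts_at M x" and d: "d \<in> charts_at N (q x)" and e: "e \<in> charts_at N (z x)"
    and E: "holomorphic_frame M N q z V E" and x: "x \<in> V" and nz: "coord_deriv q c d x \<noteq> 0"
  shows "frame_coeff N q (relative_morphism M N q z) E x = relative_quotient N q z E c d e (snd c x)"
  using frame_coeff_relative_morphism[OF M N q z c d e nz]
    holomorphic_frame_in_charts[where q=q and z=z and x=x, OF N d e E x] chart_inv[OF M, of c x] c
  by (simp add: relative_quotient_def coord_deriv_def charts_at_def)

lemma relative_quotient_differentiable:
  assumes M: "riemann_surface M" and N: "riemann_surface N"
    and q: "holomorphic_map M N q" and z: "holomorphic_map M N z"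
    and c: "c \<in> charts_at M x" and d: "d \<in> charts_at N (q x)" and e: "e \<in> charts_at N (z x)"
    and E: "holomorphic_frame M N q z V E" and x: "x \<in> V" and nz: "coord_deriv q c d x \<noteq> 0"
  shows "relative_quotient N q z E c d e field_differentiable at (snd c x)"
proof -
  have ca: "c \<in> atlas M" "x \<in> fst c" "d \<in> atlas N" "q x \<in> fst d" "e \<in> atlas N" "z x \<in> fst e"
    using c d e by (auto simp: charts_at_def)
  note H = frame_entry_holomorphic[OF M N q z ca(1,3,5) E]
  let ?S = "snd c ` (fst c \<inter> V \<inter> q -` fst d \<inter> z -` fst e)"
  have xS: "snd c x \<in> ?S" using ca x by auto
  have "E x (coord_vec N d (q x)) e \<noteq> 0"
    by (rule holomorphic_frame_in_charts[where q=q and z=z and x=x, OF N d e E x])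
  then show ?thesis
    unfolding relative_quotient_def[abs_def]
    using nz chart_inv[OF M ca(1,2)] xS H(1) holomorphic_on_imp_differentiable_at[OF H(2) H(1) xS]
      holomorphic_on_imp_differentiable_at[OF H(3) H(1) xS]
      holomorphic_on_imp_differentiable_at[OF H(4) H(1) xS]
    by (intro derivative_intros) (auto simp: coord_deriv_def)
qed

lemma Theta_in_charts:
  assumes M: "riemann_surface M" and N: "riemann_surface N"
    and q: "holomorphic_map M N q" and z: "holomorphic_map M N z"
    and c: "c \<in> charts_at M x" and d: "d \<in> charts_at N (q x)" and e: "e \<in> charts_at N (z x)"
    and E: "holomorphic_frame M N q z V E" and x: "x \<in> V"
    and W: "openin (topo M) W" "x \<in> W"
    and nz: "\<And>y. y \<in> W \<Longrightarrow> c \<in> charts_at M y \<Longrightarrow> d \<in> charts_at N (q y) \<Longrightarrow> coord_deriv q c d y \<noteq> 0"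
    and v: "v \<in> tangent_space M x"
  defines "g \<equiv> relative_quotient N q z E c d e"
  shows "(frame_coeff N q (relative_morphism M N q z) E \<circ> chart_inv c) field_differentiable at (snd c x)"
    and "Theta M N q z E x v = 2 * \<i> * (deriv g (snd c x) / g (snd c x)) * v c"
proof -
  let ?G = "frame_coeff N q (relative_morphism M N q z) E"
  have ca: "c \<in> atlas M" "x \<in> fst c" and da: "d \<in> atlas N" "q x \<in> fst d" and ea: "e \<in> atlas N" "z x \<in> fst e"
    using c d e by (auto simp: charts_at_def)
  have nzx: "coord_deriv q c d x \<noteq> 0" using nz W(2) c d by blast
  have oV: "openin (topo M) V" using E unfolding holomorphic_frame_def by blast
  have pre: "openin (topo M) {y \<in> points M. f y \<in> fst b}"
    if "holomorphic_map M N f" "b \<in> atlas N" for f b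
    using that openin_continuous_map_preimage[OF _ chart_inj(3)[OF N that(2)]]
    unfolding holomorphic_map_def by blast
  let ?W = "W \<inter> V \<inter> {y \<in> points M. q y \<in> fst d} \<inter> {y \<in> points M. z y \<in> fst e}"
  have oW: "openin (topo M) ?W" using W(1) oV pre[OF q da(1)] pre[OF z ea(1)] by (intro openin_Int)
  have xW: "x \<in> ?W" using W(2) x da ea charts_at_points[OF M c] by auto
  have eq: "?G y = g (snd c y)" if "y \<in> fst c \<inter> ?W" for y
    unfolding g_def
    by (rule frame_coeff_relative_quotient[OF M N q z _ _ _ E])
      (use that ca da ea nz in \<open>auto simp: charts_at_def\<close>)
  have gd: "g field_differentiable at (snd c x)"
    unfolding g_def by (rule relative_quotient_differentiable[OF M N q z c d e E x nzx])
  note F = field_differentiable_cong_chart[OF M c oW xW eq gd]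
  show "(?G \<circ> chart_inv c) field_differentiable at (snd c x)" by (rule F(1))
  have "?G x = g (snd c x)" using eq xW ca by blast
  then show "Theta M N q z E x v = 2 * \<i> * (deriv g (snd c x) / g (snd c x)) * v c"
    unfolding Theta_def using dlog_in_chart[OF M c v F(1)] F(2) by simp
qed

section \<open>Dual conformal nets\<close>

lemma affine_chart_at: "affine_chart \<in> charts_at sphere_surface y \<longleftrightarrow> y \<noteq> None"
  by (cases y) (auto simp: charts_at_def sphere_surface_def affine_chart_def)

lemma snd_affine_chart: "snd affine_chart = the"
  by (simp add: affine_chart_def)

lemma coordinate_frame_in_chart:
  assumes q: "q x \<noteq> None" and z: "z x \<noteq> None"
  shows "coordinate_frame z x \<in> hom_fibre sphere_surface q z x"
    and "coordinate_frame z x (coord_vec sphere_surface affine_chart (q x)) affine_chart = 1"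
proof -
  have d: "affine_chart \<in> charts_at sphere_surface (q x)" and e: "affine_chart \<in> charts_at sphere_surface (z x)"
    using q z by (auto simp: affine_chart_at)
  show "coordinate_frame z x \<in> hom_fibre sphere_surface q z x"
    by (rule hom_fibreI[where q=q and z=z and x=x and a=1 and d=affine_chart, OF riemann_surface_sphere e])
      (simp add: coordinate_frame_def)
  show "coordinate_frame z x (coord_vec sphere_surface affine_chart (q x)) affine_chart = 1"
    unfolding coordinate_frame_def
    using coord_vec_self[OF riemann_surface_sphere d] coord_vec_self[OF riemann_surface_sphere e] by simp
qed

lemma frame_coeff_coordinate_frame:
  assumes M: "riemann_surface M" and q: "holomorphic_map M sphere_surface q"
    and z: "holomorphic_map M sphere_surface z"
    and c: "c \<in> charts_at M x" and qx: "q x \<noteq> None" and zx: "z x \<noteq> None"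
    and nz: "coord_deriv q c affine_chart x \<noteq> 0"
  shows "frame_coeff sphere_surface q (relative_morphism M sphere_surface q z) (coordinate_frame z) x
    = coord_deriv z c affine_chart x / coord_deriv q c affine_chart x"
proof -
  have d: "affine_chart \<in> charts_at sphere_surface (q x)" and e: "affine_chart \<in> charts_at sphere_surface (z x)"
    using qx zx by (auto simp: affine_chart_at)
  note C = coordinate_frame_in_chart[where q=q and z=z and x=x, OF qx zx]
  show ?thesis
    using frame_coeff_relative_morphism[where q=q and z=z and E = "coordinate_frame z",
        OF M riemann_surface_sphere q z c d e nz C(1)] C(2) by simp
qed

text \<open>On a patch, \<open>q\<close> is an injective holomorphic function of the coordinate of \<open>c\<close>, so it has a holomorphic
  inverse and no critical points. This makes \<open>\<zeta>\<close> holomorphic, and \<open>z = \<zeta> \<circ> q\<close> then gives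
  \<open>dz = \<zeta>' dq\<close>.\<close>

lemma net_patch_in_chart:
  assumes M: "riemann_surface M" and q: "holomorphic_map M sphere_surface q"
    and z: "holomorphic_map M sphere_surface z"
    and c: "c \<in> atlas M" and W: "net_patch M q z W"
  defines "S \<equiv> snd c ` (fst c \<inter> W)" and "F \<equiv> affine q \<circ> chart_inv c"
    and "\<zeta> \<equiv> z_of_q q z W"
  shows "open S" "F holomorphic_on S" "open (F ` S)" "\<zeta> holomorphic_on F ` S"
    and "\<And>y. y \<in> fst c \<inter> W \<Longrightarrow> coord_deriv q c affine_chart y \<noteq> 0"
    and "\<And>y. y \<in> fst c \<inter> W \<Longrightarrow>
      coord_deriv z c affine_chart y = deriv \<zeta> (affine q y) * coord_deriv q c affine_chart y"
proof -
  have oW: "openin (topo M) W" and fin: "\<And>x. x \<in> W \<Longrightarrow> q x \<noteq> None \<and> z x \<noteq> None"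
    and inj: "inj_on (affine q) W"
    using W unfolding net_patch_def by blast+
  let ?A = "affine z \<circ> chart_inv c"
  have inv: "chart_inv c (snd c y) = y" if "y \<in> fst c" for y using chart_inv[OF M c that] .
  show oS: "open S" unfolding S_def using charts_open[OF M c oW] .
  have hol: "(affine f \<circ> chart_inv c) holomorphic_on S"
    if f: "holomorphic_map M sphere_surface f" and "\<And>x. x \<in> W \<Longrightarrow> f x \<noteq> None" for f
  proof -
    have "affine_chart \<in> atlas sphere_surface" by (simp add: sphere_surface_def)
    then have "(affine f \<circ> chart_inv c) holomorphic_on (snd c ` (fst c \<inter> f -` fst affine_chart))"
      using f c unfolding holomorphic_map_def snd_affine_chart[symmetric] by blast
    moreover have "W \<subseteq> f -` fst affine_chart" using that(2) by (force simp: affine_chart_def)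
    then have "S \<subseteq> snd c ` (fst c \<inter> f -` fst affine_chart)" unfolding S_def by blast
    ultimately show ?thesis by (rule holomorphic_on_subset)
  qed
  show F: "F holomorphic_on S" unfolding F_def by (rule hol[OF q]) (use fin in blast)
  have A: "?A holomorphic_on S" by (rule hol[OF z]) (use fin in blast)
  have injF: "inj_on F S"
  proof (rule inj_onI)
    fix u w assume "u \<in> S" "w \<in> S" "F u = F w"
    then obtain a b where ab: "a \<in> fst c \<inter> W" "b \<in> fst c \<inter> W" "u = snd c a" "w = snd c b"
      unfolding S_def by blast
    then have "affine q a = affine q b" using \<open>F u = F w\<close> inv by (simp add: F_def)
    then show "u = w" using ab inj unfolding inj_on_def by blast
  qed
  show oF: "open (F ` S)" by (rule open_mapping_thm3[OF F oS injF])
  obtain k where k: "k holomorphic_on F ` S" "\<And>w. w \<in> S \<Longrightarrow> deriv F w * deriv k (F w) = 1"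
    "\<And>w. w \<in> S \<Longrightarrow> k (F w) = w"
    using holomorphic_has_inverse[OF F oS injF] by blast
  have zF: "\<zeta> (F w) = ?A w" if w: "w \<in> S" for w
  proof -
    obtain y where y: "y \<in> fst c \<inter> W" "w = snd c y" using w unfolding S_def by blast
    then have "F w = affine q y" using inv by (simp add: F_def)
    then have "inv_into W (affine q) (F w) = y" using inj y(1) by (metis IntD2 inv_into_f_f)
    then show ?thesis using y inv by (simp add: \<zeta>_def z_of_q_def)
  qed
  show zh: "\<zeta> holomorphic_on F ` S"
  proof (rule holomorphic_transform)
    show "(?A \<circ> k) holomorphic_on F ` S"
      by (rule holomorphic_on_compose_gen[OF k(1) A]) (use k(3) in auto)
  qed (use zF k(3) in auto)
  fix y assume y: "y \<in> fst c \<inter> W"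
  then have w: "snd c y \<in> S" by (simp add: S_def)
  have Fy: "F (snd c y) = affine q y" using y inv by (simp add: F_def)
  have cq: "coord_deriv q c affine_chart y = deriv F (snd c y)"
    by (simp add: coord_deriv_def F_def snd_affine_chart)
  show "coord_deriv q c affine_chart y \<noteq> 0" using k(2)[OF w] cq by auto
  have "coord_deriv z c affine_chart y = deriv ?A (snd c y)"
    by (simp add: coord_deriv_def snd_affine_chart)
  also have "\<dots> = deriv (\<zeta> \<circ> F) (snd c y)"
    using eventually_nhds_in_open[OF oS w] zF
    by (intro deriv_cong_ev) (auto elim!: eventually_mono)
  also have "\<dots> = deriv \<zeta> (affine q y) * deriv F (snd c y)"
    unfolding Fy[symmetric] using w F zh oS oF
    by (intro deriv_chain) (auto intro: holomorphic_on_imp_differentiable_at)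
  finally show "coord_deriv z c affine_chart y = deriv \<zeta> (affine q y) * coord_deriv q c affine_chart y"
    using cq by simp
qed

text \<open>Where the net expression is defined, \<open>q\<close> and \<open>z\<close> are finite and unramified, the latter because
  \<open>dz = \<zeta>' dq\<close> with \<open>\<zeta>' \<noteq> 0\<close>.\<close>

lemma dual_net_regular:
  assumes M: "riemann_surface M" and q: "holomorphic_map M sphere_surface q"
    and z: "holomorphic_map M sphere_surface z"
    and x: "dual_net_defined M q z x" and c: "c \<in> charts_at M x"
  shows "q x \<noteq> None" "z x \<noteq> None"
    and "d \<in> charts_at sphere_surface (q x) \<Longrightarrow> coord_deriv q c d x \<noteq> 0"
    and "e \<in> charts_at sphere_surface (z x) \<Longrightarrow> coord_deriv z c e x \<noteq> 0"
proof -
  obtain W where W: "net_patch M q z W" "x \<in> W" using x unfolding dual_net_defined_def by blast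
  then show fin: "q x \<noteq> None" "z x \<noteq> None" unfolding net_patch_def by auto
  have ca: "c \<in> atlas M" "x \<in> fst c" using c by (auto simp: charts_at_def)
  note P = net_patch_in_chart[OF M q z ca(1) W(1)]
  have q0: "coord_deriv q c affine_chart x \<noteq> 0" using P(5) ca W by blast
  have "deriv (z_of_q q z W) (affine q x) \<noteq> 0" using W unfolding net_patch_def by blast
  then have z0: "coord_deriv z c affine_chart x \<noteq> 0" using P(6)[of x] q0 ca W by simp
  show "coord_deriv q c d x \<noteq> 0" if "d \<in> charts_at sphere_surface (q x)"
    using coord_deriv_target_change[OF M riemann_surface_sphere q c that, of affine_chart] fin q0
    by (auto simp: affine_chart_at)
  show "coord_deriv z c e x \<noteq> 0" if "e \<in> charts_at sphere_surface (z x)"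
    using coord_deriv_target_change[OF M riemann_surface_sphere z c that, of affine_chart] fin z0
    by (auto simp: affine_chart_at)
qed

text \<open>The two terms of the dual net expression agree. The dual one is obtained from the other by replacing
  \<open>H\<close> with \<open>1/H = \<bar>1/\<zeta>'\<bar>\<close>; this changes the sign of the logarithmic derivative, and the sign is
  restored by the subtraction. Here \<open>b\<close> stands for \<open>dq(v)\<close>.\<close>

lemma net_expression:
  assumes \<zeta>: "\<zeta> holomorphic_on D" "open D" "w \<in> D" and nz: "deriv \<zeta> w \<noteq> 0"
  shows "1 / of_real (net_H \<zeta> w) * dual_net_omega \<zeta> w * (deriv \<zeta> w * b)
      - of_real (net_H \<zeta> w) * net_omega \<zeta> w * b
    = 2 * \<i> * (deriv (deriv \<zeta>) w / deriv \<zeta> w) * b"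
proof -
  have fd: "deriv \<zeta> field_differentiable at w"
    using holomorphic_deriv[OF \<zeta>(1,2)] \<zeta>(2,3) by (rule holomorphic_on_imp_differentiable_at)
  have 1: "wirtinger (\<lambda>u. of_real (ln (net_H \<zeta> u))) w = deriv (deriv \<zeta>) w / (2 * deriv \<zeta> w)"
    unfolding net_H_def by (rule wirtinger_ln_norm[OF fd nz])
  have "wirtinger (\<lambda>u. of_real (ln (dual_net_H \<zeta> u))) w
      = wirtinger (\<lambda>u. of_real (ln (norm (inverse (deriv \<zeta> u))))) w"
    by (simp add: dual_net_H_def net_H_def norm_inverse)
  also have "\<dots> = deriv (\<lambda>u. inverse (deriv \<zeta> u)) w / (2 * inverse (deriv \<zeta> w))"
    using fd nz by (intro wirtinger_ln_norm field_differentiable_inverse) auto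
  also have "deriv (\<lambda>u. inverse (deriv \<zeta> u)) w = - deriv (deriv \<zeta>) w / (deriv \<zeta> w)\<^sup>2"
    using deriv_inverse[OF fd nz] .
  finally have 2: "wirtinger (\<lambda>u. of_real (ln (dual_net_H \<zeta> u))) w
      = - (deriv (deriv \<zeta>) w / (2 * deriv \<zeta> w))"
    using nz by (simp add: field_simps power2_eq_square)
  have H: "net_H \<zeta> w \<noteq> 0" using nz by (simp add: net_H_def)
  show ?thesis
    unfolding net_omega_def dual_net_omega_def wirtinger_z_def 1 2
    unfolding dual_net_H_def
    using H nz by (simp add: field_simps)
qed

text \<open>On the whole patch the coefficient of \<open>\<Z>\<close> in the coordinate frame is \<open>\<zeta>' \<circ> q\<close>, whose logarithmic
  differential is \<open>(\<zeta>''/\<zeta>') dq\<close>.\<close>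

lemma dual_net_form_eq_Theta:
  assumes M: "riemann_surface M" and q: "holomorphic_map M sphere_surface q"
    and z: "holomorphic_map M sphere_surface z"
    and x: "dual_net_defined M q z x" and v: "v \<in> tangent_space M x" and xp: "x \<in> points M"
  shows "dual_net_form M q z x v = Theta M sphere_surface q z (coordinate_frame z) x v"
proof -
  \<comment> \<open>The patch and the chart are the ones that occur in the definitions of the net form and of \<open>fun_d\<close>.\<close>
  define W where "W = (SOME W. net_patch M q z W \<and> x \<in> W)"
  have "\<exists>W. net_patch M q z W \<and> x \<in> W" using x unfolding dual_net_defined_def .
  then have W: "net_patch M q z W" "x \<in> W" unfolding W_def by (metis (mono_tags, lifting) someI_ex)+
  have oW: "openin (topo M) W" using W(1) unfolding net_patch_def by blast
  define c where "c = chart_at M x"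
  have c: "c \<in> charts_at M x" unfolding c_def by (rule chart_at_in[OF M xp])
  have ca: "c \<in> atlas M" "x \<in> fst c" using c by (auto simp: charts_at_def)
  note P = net_patch_in_chart[OF M q z ca(1) W(1)]
  define \<zeta> where "\<zeta> = z_of_q q z W"
  define F where "F = affine q \<circ> chart_inv c"
  have Fx: "F (snd c x) = affine q x" using chart_inv[OF M ca] by (simp add: F_def)
  have xS: "snd c x \<in> snd c ` (fst c \<inter> W)" using ca W by blast
  have D: "affine q x \<in> F ` (snd c ` (fst c \<inter> W))" using xS Fx by (metis image_eqI)
  have nz: "deriv \<zeta> (affine q x) \<noteq> 0" using W unfolding net_patch_def \<zeta>_def by blast
  have fin: "q y \<noteq> None \<and> z y \<noteq> None" if "y \<in> W" for y using W(1) that unfolding net_patch_def by blast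
  have dq: "fun_d M (affine q) x v = deriv F (snd c x) * v c"
    by (simp add: fun_d_def c_def F_def)
  have dz: "fun_d M (affine z) x v = deriv \<zeta> (affine q x) * fun_d M (affine q) x v"
    using P(6)[of x] ca W by (simp add: fun_d_def c_def coord_deriv_def snd_affine_chart \<zeta>_def)
  have zh: "\<zeta> holomorphic_on F ` (snd c ` (fst c \<inter> W))" and oF: "open (F ` (snd c ` (fst c \<inter> W)))"
    using P(3,4) by (simp_all add: \<zeta>_def F_def)
  have net: "dual_net_form M q z x v
      = 2 * \<i> * (deriv (deriv \<zeta>) (affine q x) / deriv \<zeta> (affine q x)) * fun_d M (affine q) x v"
    unfolding dual_net_form_def W_def[symmetric] Let_def \<zeta>_def[symmetric] dz
    by (rule net_expression[OF zh oF D nz])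
  let ?G = "frame_coeff sphere_surface q (relative_morphism M sphere_surface q z) (coordinate_frame z)"
  have G: "?G y = deriv \<zeta> (affine q y)" if y: "y \<in> fst c \<inter> W" for y
  proof -
    have cy: "c \<in> charts_at M y" using y ca by (simp add: charts_at_def)
    show ?thesis
      using frame_coeff_coordinate_frame[OF M q z cy _ _ P(5)[OF y]] P(5,6)[OF y] fin[of y] y
      by (simp add: \<zeta>_def)
  qed
  have Fd: "F field_differentiable at (snd c x)"
    using P(1,2) xS unfolding F_def by (metis holomorphic_on_imp_differentiable_at)
  have zd: "deriv \<zeta> field_differentiable at (F (snd c x))"
    using holomorphic_deriv[OF zh oF] oF D unfolding Fx by (rule holomorphic_on_imp_differentiable_at)
  have fd: "(deriv \<zeta> \<circ> F) field_differentiable at (snd c x)"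
    by (rule field_differentiable_compose[OF Fd zd])
  have eq: "?G y = (deriv \<zeta> \<circ> F) (snd c y)" if "y \<in> fst c \<inter> W" for y
    using G[OF that] chart_inv[OF M ca(1)] that by (simp add: F_def)
  note K = field_differentiable_cong_chart[OF M c oW W(2) eq fd]
  have "deriv (deriv \<zeta> \<circ> F) (snd c x) = deriv (deriv \<zeta>) (affine q x) * deriv F (snd c x)"
    using deriv_chain[OF Fd zd] Fx by simp
  then have "dlog M ?G x v = deriv (deriv \<zeta>) (affine q x) * deriv F (snd c x) / deriv \<zeta> (affine q x) * v c"
    using dlog_in_chart[OF M c v K(1)] K(2) G[of x] ca W by simp
  then show ?thesis unfolding net Theta_def dq by simp
qed

text \<open>With \<open>E = h (\<partial>/\<partial>z \<otimes> dq)\<close>, the coefficient of \<open>\<Z>\<close> in the coordinate frame is \<open>h\<close> times its coefficient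
  in \<open>E\<close>; logarithmic differentials turn the product into a sum, from which the gauge law removes
  the summand \<open>2i dlog h\<close>.\<close>

lemma change_frame_dual_net_form:
  assumes M: "riemann_surface M" and q: "holomorphic_map M sphere_surface q"
    and z: "holomorphic_map M sphere_surface z"
    and E: "holomorphic_frame M sphere_surface q z V E" and xV: "x \<in> V"
    and x: "dual_net_defined M q z x" and v: "v \<in> tangent_space M x"
  shows "change_frame M sphere_surface q (coordinate_frame z) E (dual_net_form M q z) x v
    = Theta M sphere_surface q z E x v"
proof -
  let ?N = "sphere_surface" and ?a = affine_chart and ?C = "coordinate_frame z"
  let ?R = "relative_morphism M ?N q z"
  have oV: "openin (topo M) V" using E unfolding holomorphic_frame_def by blast
  have xp: "x \<in> points M" using oV xV openin_subset by blast
  obtain W where W: "net_patch M q z W" "x \<in> W" using x unfolding dual_net_defined_def by blast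
  have oW: "openin (topo M) W" using W(1) unfolding net_patch_def by blast
  have Wd: "dual_net_defined M q z y" if "y \<in> W" for y using W(1) that unfolding dual_net_defined_def by blast
  define c where "c = chart_at M x"
  have c: "c \<in> charts_at M x" unfolding c_def by (rule chart_at_in[OF M xp])
  have ca: "c \<in> atlas M" "x \<in> fst c" using c by (auto simp: charts_at_def)
  let ?W = "V \<inter> W \<inter> fst c"
  have oW': "openin (topo M) ?W" using oV oW chart_inj(3)[OF M ca(1)] by blast
  have xW: "x \<in> ?W" using xV W ca by blast
  have cy: "c \<in> charts_at M y" if "y \<in> ?W" for y using that ca by (simp add: charts_at_def)
  have at: "?a \<in> charts_at ?N (q y)" "?a \<in> charts_at ?N (z y)" "q y \<noteq> None" "z y \<noteq> None"
    "coord_deriv q c ?a y \<noteq> 0" "coord_deriv z c ?a y \<noteq> 0" if "y \<in> ?W" for y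
    using dual_net_regular[OF M q z Wd cy] that by (auto simp: affine_chart_at)
  let ?e = "\<lambda>y. E y (coord_vec ?N ?a (q y)) ?a"
  have e: "E y \<in> hom_fibre ?N q z y" "?e y \<noteq> 0" if "y \<in> ?W" for y
    using holomorphic_frame_in_charts[where q=q and z=z and x=y, OF riemann_surface_sphere at(1,2)[OF that] E] that by auto
  have h: "frame_coeff ?N q E ?C y = ?e y" if "y \<in> ?W" for y
    using frame_coeff_in_charts[where q=q and z=z and x=y and S=E and E="?C",
        OF riemann_surface_sphere at(1,2)[OF that] e(1)[OF that]]
      coordinate_frame_in_chart[where q=q and z=z and x=y, OF at(3,4)[OF that]] by simp
  have gE: "frame_coeff ?N q ?R E y = coord_deriv z c ?a y / (coord_deriv q c ?a y * ?e y)" if "y \<in> ?W" for y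
    using frame_coeff_relative_morphism[where q=q and z=z and E=E,
        OF M riemann_surface_sphere q z cy[OF that] at(1,2,5)[OF that] e[OF that]] .
  have gC: "frame_coeff ?N q ?R ?C y = frame_coeff ?N q E ?C y * frame_coeff ?N q ?R E y" if "y \<in> ?W" for y
    unfolding h[OF that] gE[OF that]
    using frame_coeff_coordinate_frame[OF M q z cy[OF that] at(3,4,5)[OF that]] e(2)[OF that] by simp
  have aN: "?a \<in> atlas ?N" by (simp add: sphere_surface_def)
  note H = frame_entry_holomorphic[OF M riemann_surface_sphere q z ca(1) aN aN E]
  have xS: "snd c x \<in> snd c ` (fst c \<inter> V \<inter> q -` fst ?a \<inter> z -` fst ?a)"
    using ca xV at(1,2)[OF xW] by (auto simp: charts_at_def)
  have hd: "(frame_coeff ?N q E ?C \<circ> chart_inv c) field_differentiable at (snd c x)"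
    by (rule field_differentiable_cong_chart(1)[OF M c oW' xW _ holomorphic_on_imp_differentiable_at[OF H(4) H(1) xS]])
      (use h chart_inv[OF M ca(1)] in auto)
  have kd: "(frame_coeff ?N q ?R E \<circ> chart_inv c) field_differentiable at (snd c x)"
    by (rule Theta_in_charts(1)[OF M riemann_surface_sphere q z c at(1,2)[OF xW] E xV oW' xW _ v])
      (rule at(5))
  have "dlog M (frame_coeff ?N q ?R ?C) x v
      = dlog M (frame_coeff ?N q E ?C) x v + dlog M (frame_coeff ?N q ?R E) x v"
    by (rule dlog_mult[OF M c v oW' xW gC hd _ kd])
      (use h[OF xW] gE[OF xW] e(2)[OF xW] at(5,6)[OF xW] in auto)
  then show ?thesis
    unfolding change_frame_def dual_net_form_eq_Theta[OF M q z x v xp] Theta_def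
    by (simp add: algebra_simps)
qed

section \<open>The residue at the puncture\<close>

lemma vanishing_order_in_charts:
  assumes M: "riemann_surface M" and N: "riemann_surface N" and f: "holomorphic_map M N f"
    and p: "p \<in> points M"
  defines "c \<equiv> chart_at M p" and "d \<equiv> chart_at N (f p)"
  shows "vanishing_order M N f p = zorder (deriv (snd d \<circ> f \<circ> chart_inv c)) (snd c p)"
proof -
  have d: "d \<in> charts_at N (f p)"
    unfolding d_def by (rule chart_at_in[OF N holomorphic_map_points[OF f p]])
  have c: "c \<in> charts_at M p" unfolding c_def by (rule chart_at_in[OF M p])
  have ca: "c \<in> atlas M" "p \<in> fst c" and da: "d \<in> atlas N" "f p \<in> fst d"
    using c d by (auto simp: charts_at_def)
  have eq: "differential M N f (chart_inv c w) (coord_vec M c (chart_inv c w)) d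
      = deriv (snd d \<circ> f \<circ> chart_inv c) w" if "w \<in> snd c ` (fst c \<inter> f -` fst d)" for w
  proof -
    obtain y where y: "y \<in> fst c" "f y \<in> fst d" "w = snd c y" using \<open>w \<in> _\<close> by blast
    have cy: "c \<in> charts_at M y" and dy: "d \<in> charts_at N (f y)" using y ca da by (auto simp: charts_at_def)
    show ?thesis
      using differential_in_charts[OF M N f cy dy coord_vec_tangent[OF M cy]] coord_vec_self[OF M cy]
        chart_inv[OF M ca(1) y(1)] y(3) by (simp add: coord_deriv_def)
  qed
  have "snd c p \<in> snd c ` (fst c \<inter> f -` fst d)" using ca da by blast
  from eventually_at_in_open[OF holomorphic_map_in_charts(1)[OF M N f ca(1) da(1)] this] eq
  show ?thesis unfolding vanishing_order_def Let_def c_def[symmetric] d_def[symmetric]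
    by (intro zorder_cong) (auto elim!: eventually_mono)
qed

text \<open>
  The regularity assumptions say that \<open>q\<close> and \<open>z\<close> are unramified on \<open>U - {p}\<close>. Then the coefficient
  of \<open>\<Z>\<close> in the frame \<open>E\<close> is a quotient whose numerator and denominator are holomorphic at \<open>p\<close> and
  vanish nowhere else nearby, to the orders \<open>r\<^sub>z\<close> and \<open>r\<^sub>q\<close> at \<open>p\<close>; the entry of \<open>E\<close> contributes
  order \<open>0\<close>. Residues and meromorphy only see the punctured neighbourhood, so the statement is made for every
  form that agrees there with \<open>\<Theta>\<close>. It covers both \<open>\<Theta>\<close> itself and the net form after
  the change of frame.\<close>

lemma logarithmic_connection_residue:
  assumes M: "riemann_surface M" and N: "riemann_surface N"
    and q: "holomorphic_map M N q" and z: "holomorphic_map M N z"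
    and E: "holomorphic_frame M N q z V E" and pV: "p \<in> V"
    and U: "openin (topo M) U" "p \<in> U"
    and qreg: "\<And>y c d. y \<in> U - {p} \<Longrightarrow> c \<in> charts_at M y \<Longrightarrow> d \<in> charts_at N (q y) \<Longrightarrow>
      coord_deriv q c d y \<noteq> 0"
    and zreg: "\<And>y c e. y \<in> U - {p} \<Longrightarrow> c \<in> charts_at M y \<Longrightarrow> e \<in> charts_at N (z y) \<Longrightarrow>
      coord_deriv z c e y \<noteq> 0"
    and eq: "\<And>y v. y \<in> (U \<inter> V) - {p} \<Longrightarrow> v \<in> tangent_space M y \<Longrightarrow> \<eta> y v = Theta M N q z E y v"
  shows "meromorphic_form_at M \<eta> p"
    and "form_residue M \<eta> p
      = 2 * \<i> * (of_int (vanishing_order M N z p) - of_int (vanishing_order M N q p))"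
proof -
  have p: "p \<in> points M" using U openin_subset by blast
  have "Hausdorff_space (topo M)" using M unfolding riemann_surface_def by blast
  then have "closedin (topo M) {p}" by (rule closedin_Hausdorff_singleton[OF _ p])
  then have oU: "openin (topo M) (U - {p})" by (rule openin_diff[OF U(1)])
  define d where "d = chart_at N (q p)"
  define e where "e = chart_at N (z p)"
  have d: "d \<in> charts_at N (q p)" and e: "e \<in> charts_at N (z p)"
    unfolding d_def e_def
    by (intro chart_at_in[OF N] holomorphic_map_points[OF q p] holomorphic_map_points[OF z p])+
  have da: "d \<in> atlas N" "q p \<in> fst d" and ea: "e \<in> atlas N" "z p \<in> fst e"
    using d e by (auto simp: charts_at_def)
  have in_chart: "form_coeff M c \<eta> meromorphic_on {snd c p}"
    "residue (form_coeff M c \<eta>) (snd c p) = 2 * \<i> *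
        (of_int (zorder (deriv (snd e \<circ> z \<circ> chart_inv c)) (snd c p))
         - of_int (zorder (deriv (snd d \<circ> q \<circ> chart_inv c)) (snd c p)))"
    if c: "c \<in> charts_at M p" for c
  proof -
    have ca: "c \<in> atlas M" "p \<in> fst c" using c by (auto simp: charts_at_def)
    define S where "S = snd c ` (fst c \<inter> V \<inter> q -` fst d \<inter> z -` fst e) \<inter> snd c ` (fst c \<inter> U)"
    note H = frame_entry_holomorphic[OF M N q z ca(1) da(1) ea(1) E]
    have S: "open S" "snd c p \<in> S"
      unfolding S_def using H(1) charts_open[OF M ca(1) U(1)] ca da ea pV U by auto
    let ?A = "deriv (snd e \<circ> z \<circ> chart_inv c)" and ?B = "deriv (snd d \<circ> q \<circ> chart_inv c)"
      and ?C = "\<lambda>w. E (chart_inv c w) (coord_vec N d (q (chart_inv c w))) e"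
      and ?g = "relative_quotient N q z E c d e"
    have hol: "?A holomorphic_on S" "?B holomorphic_on S" "?C holomorphic_on S"
      using H(2,3,4) by (auto intro: holomorphic_on_subset simp: S_def)
    have ex: "\<exists>y. w = snd c y \<and> c \<in> charts_at M y \<and> d \<in> charts_at N (q y) \<and> e \<in> charts_at N (z y)
        \<and> y \<in> U \<inter> V" if w: "w \<in> S" for w
    proof -
      obtain y y' where y: "y \<in> fst c" "y \<in> V" "q y \<in> fst d" "z y \<in> fst e" "w = snd c y"
        "y' \<in> fst c" "y' \<in> U" "w = snd c y'" using w unfolding S_def by blast
      then have "y' = y" using chart_inj(1)[OF M ca(1)] by (metis inj_onD)
      then show ?thesis using y ca da ea by (auto simp: charts_at_def)
    qed
    have nzC: "?C w \<noteq> 0" if w: "w \<in> S" for w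
    proof -
      obtain y where y: "w = snd c y" "c \<in> charts_at M y" "d \<in> charts_at N (q y)"
        "e \<in> charts_at N (z y)" "y \<in> U \<inter> V"
        using ex[OF w] by blast
      then have "chart_inv c w = y" using chart_inv[OF M ca(1)] by (simp add: charts_at_def)
      then show ?thesis
        using holomorphic_frame_in_charts(2)[where q=q and z=z and x=y, OF N y(3,4) E] y(5) by simp
    qed
    have nzAB: "?A w \<noteq> 0 \<and> ?B w \<noteq> 0 \<and> form_coeff M c \<eta> w = 2 * \<i> * (deriv ?g w / ?g w)"
      if w: "w \<in> S - {snd c p}" for w
    proof -
      obtain y where y: "w = snd c y" "c \<in> charts_at M y" "d \<in> charts_at N (q y)"
        "e \<in> charts_at N (z y)" "y \<in> U \<inter> V"
        using ex w by blast
      then have yU: "y \<in> U - {p}" "y \<in> (U \<inter> V) - {p}" using w by auto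
      have inv: "chart_inv c w = y" using chart_inv[OF M ca(1)] y by (simp add: charts_at_def)
      have v: "coord_vec M c y \<in> tangent_space M y" by (rule coord_vec_tangent[OF M y(2)])
      have "\<eta> y (coord_vec M c y) = Theta M N q z E y (coord_vec M c y)" by (rule eq[OF yU(2) v])
      also have "\<dots> = 2 * \<i> * (deriv ?g w / ?g w)"
        unfolding y(1)
        using Theta_in_charts(2)[OF M N q z y(2,3,4) E _ oU yU(1) qreg v] y(5)
          coord_vec_self[OF M y(2)] by simp
      finally have "form_coeff M c \<eta> w = 2 * \<i> * (deriv ?g w / ?g w)"
        by (simp add: form_coeff_def inv)
      moreover have "?B w \<noteq> 0"
        using qreg[OF yU(1) y(2,3)] y(1) by (simp add: coord_deriv_def)
      moreover have "?A w \<noteq> 0"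
        using zreg[OF yU(1) y(2,4)] y(1) by (simp add: coord_deriv_def)
      ultimately show ?thesis by blast
    qed
    have ev: "\<forall>\<^sub>F w in at (snd c p). form_coeff M c \<eta> w = 2 * \<i> * (deriv ?g w / ?g w)"
      using eventually_at_in_open[OF S] nzAB by (auto elim!: eventually_mono)
    have g: "?g meromorphic_on {snd c p}"
      unfolding relative_quotient_def[abs_def]
      by (rule residue_logderiv_quotient(1)[OF S hol]) (use nzAB nzC in auto)
    then have "(\<lambda>w. 2 * \<i> * (deriv ?g w / ?g w)) meromorphic_on {snd c p}"
      by (intro meromorphic_intros)
    then show "form_coeff M c \<eta> meromorphic_on {snd c p}"
      by (subst meromorphic_on_cong[OF _ refl]) (use ev in auto)
    have "residue (form_coeff M c \<eta>) (snd c p) = residue (\<lambda>w. 2 * \<i> * (deriv ?g w / ?g w)) (snd c p)"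
      by (rule residue_cong[OF ev refl])
    also have "\<dots> = 2 * \<i> * (of_int (zorder ?A (snd c p)) - of_int (zorder ?B (snd c p)))"
      unfolding relative_quotient_def[abs_def]
      by (rule residue_logderiv_quotient(2)[OF S hol]) (use nzAB nzC in auto)
    finally show "residue (form_coeff M c \<eta>) (snd c p)
      = 2 * \<i> * (of_int (zorder ?A (snd c p)) - of_int (zorder ?B (snd c p)))" .
  qed
  show "meromorphic_form_at M \<eta> p" unfolding meromorphic_form_at_def using in_chart(1) by blast
  show "form_residue M \<eta> p
      = 2 * \<i> * (of_int (vanishing_order M N z p) - of_int (vanishing_order M N q p))"
    unfolding form_residue_def vanishing_order_in_charts[OF M N q p] vanishing_order_in_charts[OF M N z p]
    using in_chart(2)[OF chart_at_in[OF M p]] by (simp add: d_def e_def)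
qed

theorem corollary10p3:
  fixes X :: "'a surface"
    and q z :: "'a \<Rightarrow> complex option"
    and p :: 'a
    and U :: "'a set"
  assumes "riemann_surface X"
    and "compact_space (topo X)"
    and "connected_space (topo X)"
    and "holomorphic_map X sphere_surface q"
    and "\<not> q constant_on points X"
    and "holomorphic_map X sphere_surface z"
    and "\<not> z constant_on points X"
    and "p \<in> points X"
    and "openin (topo X) U"
    and "p \<in> U"
    and "\<forall>x\<in>U - {p}. dual_net_defined X q z x"
  shows "(\<forall>x\<in>U - {p}. \<forall>v\<in>tangent_space X x.
            dual_net_form X q z x v = Theta X sphere_surface q z (coordinate_frame z) x v) \<and>
         (\<forall>V E. holomorphic_frame X sphere_surface q z V E \<and> p \<in> V \<longrightarrow>
           (let \<eta> = change_frame X sphere_surface q (coordinate_frame z) E (dual_net_form X q z);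
                \<Theta> = Theta X sphere_surface q z E;
                r\<^sub>q = vanishing_order X sphere_surface q p;
                r\<^sub>z = vanishing_order X sphere_surface z p
            in meromorphic_form_at X \<eta> p \<and>
               meromorphic_form_at X \<Theta> p \<and>
               (\<forall>x\<in>(U \<inter> V) - {p}. \<forall>v\<in>tangent_space X x. \<eta> x v = \<Theta> x v) \<and>
               form_residue X \<eta> p = 2 * \<i> * (of_int r\<^sub>z - of_int r\<^sub>q) \<and>
               (form_residue X \<eta> p \<noteq> 0 \<longrightarrow> r\<^sub>z \<noteq> r\<^sub>q)))"
proof (intro conjI ballI allI impI)
  note M = assms(1) and q = assms(4) and z = assms(6) and U = assms(9,10)
  note N = riemann_surface_sphere
  let ?N = sphere_surface
  have net: "dual_net_defined X q z x" if "x \<in> U - {p}" for x using assms(11) that by blast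
  show "dual_net_form X q z x v = Theta X ?N q z (coordinate_frame z) x v"
    if "x \<in> U - {p}" "v \<in> tangent_space X x" for x v
    by (rule dual_net_form_eq_Theta[OF M q z net that(2)]) (use that(1) U openin_subset in auto)
  fix V E assume "holomorphic_frame X ?N q z V E \<and> p \<in> V"
  then have E: "holomorphic_frame X ?N q z V E" and pV: "p \<in> V" by auto
  define \<eta> where "\<eta> = change_frame X ?N q (coordinate_frame z) E (dual_net_form X q z)"
  have eq: "\<eta> x v = Theta X ?N q z E x v" if "x \<in> (U \<inter> V) - {p}" "v \<in> tangent_space X x" for x v
    unfolding \<eta>_def
    by (rule change_frame_dual_net_form[OF M q z E _ net that(2)]) (use that(1) in auto)
  note residue = logarithmic_connection_residue[OF M N q z E pV U
      dual_net_regular(3)[OF M q z net] dual_net_regular(4)[OF M q z net]]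
  have "meromorphic_form_at X \<eta> p"
    "form_residue X \<eta> p = 2 * \<i> * (of_int (vanishing_order X ?N z p) - of_int (vanishing_order X ?N q p))"
    by (rule residue; use eq in blast)+
  moreover have "meromorphic_form_at X (Theta X ?N q z E) p"
    by (rule residue(1)) auto
  ultimately show "let \<eta> = change_frame X ?N q (coordinate_frame z) E (dual_net_form X q z);
            \<Theta> = Theta X ?N q z E;
            r\<^sub>q = vanishing_order X ?N q p;
            r\<^sub>z = vanishing_order X ?N z p
        in meromorphic_form_at X \<eta> p \<and> meromorphic_form_at X \<Theta> p \<and>
           (\<forall>x\<in>(U \<inter> V) - {p}. \<forall>v\<in>tangent_space X x. \<eta> x v = \<Theta> x v) \<and>
           form_residue X \<eta> p = 2 * \<i> * (of_int r\<^sub>z - of_int r\<^sub>q) \<and>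
           (form_residue X \<eta> p \<noteq> 0 \<longrightarrow> r\<^sub>z \<noteq> r\<^sub>q)"
    unfolding Let_def \<eta>_def[symmetric] using eq by auto
qed

end
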